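(* Let $\mathcal{L}$ be a tame fragment of $\mathrm{SOL}$ such that the rich disjoint union $\sqcup_{rich}$ is $\mathcal{L}$-smooth, and let $\Box$ be an $\mathcal{L}$-sum-like binary operation on $\tau$-structures. Let $P$ be an $\mathcal{L}(\tau)$-polynomial. Then the connection matrix $M(\Box,P)$ has finite rank.
   Context: $\tau$ is a finite relational vocabulary (possibly with constant symbols). A subset $\mathcal{L}$ of second-order logic $\mathrm{SOL}$ is a fragment if: for each such $\tau$, $\mathcal{L}(\tau)$ contains the atomic $\tau$-formulas and is closed under $\wedge,\vee,\neg$ and renaming of relation and constant symbols; there is a quantifier rank $qr:\mathcal{L}\to\mathbb{N}$, $0$ on atomic formulas, equal to the maximum on Boolean combinations, and sub-additive under substitution; for each $q$ and fixed set of free variables there are only finitely many formulas of quantifier rank $\le q$ up to logical equivalence; and for $\phi(x)\in\mathcal{L}$, $\exists x\phi(x)$ is equivalent to a formula of $\mathcal{L}$. A scalar $\mathcal{L}$-transduction $\Phi$ from $\tau$- to $\sigma$-structures consists of $\mathcal{L}(\tau)$-formulas $\phi_{univ}(x)$ and, for each $k$-ary $R\in\sigma$, $\phi_R(x_1,\dots,x_k)$; $\Phi^\star(\mathfrak{A})$ is the $\sigma$-structure with universe $\{a:\mathfrak{A}\models\phi_{univ}(a)\}$ and $R$ interpreted by $\phi_R$; $\Phi^\sharp(\theta)$ is the induced backward translation of a $\sigma$-formula $\theta$ into a $\tau$-formula with $\Phi^\star(\mathfrak{A})\models\theta$ iff $\mathfrak{A}\models\Phi^\sharp(\theta)$. $\mathcal{L}$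 is tame if $\Phi^\sharp(\theta)\in\mathcal{L}(\tau)$ whenever $\Phi$ is a scalar transduction with formulas in $\mathcal{L}(\tau)$ and $\theta\in\mathcal{L}(\sigma)$, and $\mathcal{L}$ is closed under forming $\forall x(\varphi(x)\to\psi(x))$. Write $\mathfrak{A}\equiv_q\mathfrak{B}$ if $\mathfrak{A},\mathfrak{B}$ satisfy the same $\mathcal{L}$-sentences of quantifier rank $\le q$; an operation $\Box$ is $\mathcal{L}$-smooth if $\mathfrak{A}_1\equiv_q\mathfrak{B}_1$ and $\mathfrak{A}_2\equiv_q\mathfrak{B}_2$ imply $\mathfrak{A}_1\Box\mathfrak{A}_2\equiv_q\mathfrak{B}_1\Box\mathfrak{B}_2$ for all $q$. The rich disjoint union $\mathfrak{A}\sqcup_{rich}\mathfrak{B}$ is the disjoint union expanded by two unary predicates for $A$ and $B$. $\Box$ is $\mathcal{L}$-sum-like if there is a scalar $\mathcal{L}$-transduction $\Phi$ with $\mathfrak{A}\Box\mathfrak{B}=\Phi^\star(\mathfrak{A}\sqcup_{rich}\mathfrak{B})$ for all $\mathfrak{A},\mathfrak{B}$. $\mathcal{L}(\tau)$-polynomials, over a fixed finite set $\mathbf{X}$ of indeterminates, are defined inductively for a $\tau$-structure $\mathcal{M}$: simple monomials are elements of $\mathbb{N}\cup\mathbf{X}$; monomials are simple monomials, expressions $\prod_{a:\langle\mathcal{M},a\rangle\models\phi(a)}t$ with $\phi\in\mathcal{L}(\tau\cup\{a\})$, $a$ a new constant and $t$ a simple monomial, and finite products of monomials; polynomials are monomials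 and expressions $\sum_{\bar a:\langle\mathcal{M},\bar a\rangle\models\phi(\bar a)}t$ and $\sum_{\bar R:\langle\mathcal{M},\bar R\rangle\models\phi(\bar R)}t$ where $\bar a$ are new constants, $\bar R$ new relation symbols, $\phi$ an $\mathcal{L}$-formula over the expanded vocabulary and $t$ an $\mathcal{L}$-polynomial over the expanded vocabulary. The connection matrix $M(\Box,P)$ has rows and columns indexed by the finite $\tau$-structures and entry $P(\mathfrak{A}\Box\mathfrak{B})$ at $(\mathfrak{A},\mathfrak{B})$; its rank is taken over the field of rational functions in the indeterminates $\mathbf{X}$.
   Formalization: In L-polynomials, sums over new relation symbols are restricted to arity at most 1; for binary symbols the claim fails, since summing 1 over all linear orders gives |A|!, whose connection matrix ((i+j)!) under disjoint union has infinite rank. *)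

theory Defs
  imports
    "HOL-Library.Poly_Mapping"
    "HOL-Library.Function_Algebras"
    "HOL-Library.Nat_Bijection"
    "HOL-Library.Extended_Nat"
    "HOL-Computational_Algebra.Fraction_Field"
begin

section \<open>Second-order logic over finite structures\<close>

text \<open>
  \<open>RSym n k\<close> is the \<open>n\<close>-th relation symbol of arity \<open>k\<close>. The remaining constructors provide the
  symbols of the vocabulary of a rich disjoint union: a tagged copy of every relation symbol, two
  new unary predicates for the two parts, and two copies of every constant symbol. As fragments
  are closed under renaming, the tags only serve to make the new symbols distinct from the old ones.
\<close>

datatype rsym = RSym nat nat | RIn rsym | PLeft | PRight

datatype csym = CSym nat | CLeft csym | CRight csym

primrec arity :: "rsym \<Rightarrow> nat" where
  "arity (RSym n k) = k"
| "arity (RIn R) = arity R"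
| "arity PLeft = 1"
| "arity PRight = 1"

record vocab =
  rels :: "rsym set"
  csts :: "csym set"

definition vocabulary :: "vocab \<Rightarrow> bool" where
  "vocabulary \<tau> \<longleftrightarrow> finite (rels \<tau>) \<and> finite (csts \<tau>)"

text \<open>A relation variable is a pair of a name and an arity.\<close>

type_synonym rvar = "nat \<times> nat"

datatype tm = Var nat | Const csym

datatype form =
    Eq tm tm
  | Rel rsym "tm list"
  | RVar rvar "tm list"
  | Neg form
  | Conj form form
  | Disj form form
  | Ex nat form
  | All nat form
  | Ex2 rvar form
  | All2 rvar form

abbreviation Imp :: "form \<Rightarrow> form \<Rightarrow> form" where
  "Imp \<phi> \<psi> \<equiv> Disj (Neg \<phi>) \<psi>"

fun atomic :: "form \<Rightarrow> bool" where
  "atomic (Eq t u) = True"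
| "atomic (Rel R ts) = True"
| "atomic (RVar X ts) = True"
| "atomic _ = False"

primrec tm_vars :: "tm \<Rightarrow> nat set" where
  "tm_vars (Var x) = {x}"
| "tm_vars (Const c) = {}"

primrec tm_over :: "vocab \<Rightarrow> tm \<Rightarrow> bool" where
  "tm_over \<tau> (Var x) = True"
| "tm_over \<tau> (Const c) = (c \<in> csts \<tau>)"

text \<open>Free first-order variables and free relation variables.\<close>

primrec fv :: "form \<Rightarrow> nat set" where
  "fv (Eq t u) = tm_vars t \<union> tm_vars u"
| "fv (Rel R ts) = (\<Union>t\<in>set ts. tm_vars t)"
| "fv (RVar X ts) = (\<Union>t\<in>set ts. tm_vars t)"
| "fv (Neg \<phi>) = fv \<phi>"
| "fv (Conj \<phi> \<psi>) = fv \<phi> \<union> fv \<psi>"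
| "fv (Disj \<phi> \<psi>) = fv \<phi> \<union> fv \<psi>"
| "fv (Ex x \<phi>) = fv \<phi> - {x}"
| "fv (All x \<phi>) = fv \<phi> - {x}"
| "fv (Ex2 X \<phi>) = fv \<phi>"
| "fv (All2 X \<phi>) = fv \<phi>"

primrec frv :: "form \<Rightarrow> rvar set" where
  "frv (Eq t u) = {}"
| "frv (Rel R ts) = {}"
| "frv (RVar X ts) = {X}"
| "frv (Neg \<phi>) = frv \<phi>"
| "frv (Conj \<phi> \<psi>) = frv \<phi> \<union> frv \<psi>"
| "frv (Disj \<phi> \<psi>) = frv \<phi> \<union> frv \<psi>"
| "frv (Ex x \<phi>) = frv \<phi>"
| "frv (All x \<phi>) = frv \<phi>"
| "frv (Ex2 X \<phi>) = frv \<phi> - {X}"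
| "frv (All2 X \<phi>) = frv \<phi> - {X}"

primrec over :: "vocab \<Rightarrow> form \<Rightarrow> bool" where
  "over \<tau> (Eq t u) = (tm_over \<tau> t \<and> tm_over \<tau> u)"
| "over \<tau> (Rel R ts) = (R \<in> rels \<tau> \<and> length ts = arity R \<and> (\<forall>t\<in>set ts. tm_over \<tau> t))"
| "over \<tau> (RVar X ts) = (length ts = snd X \<and> (\<forall>t\<in>set ts. tm_over \<tau> t))"
| "over \<tau> (Neg \<phi>) = over \<tau> \<phi>"
| "over \<tau> (Conj \<phi> \<psi>) = (over \<tau> \<phi> \<and> over \<tau> \<psi>)"
| "over \<tau> (Disj \<phi> \<psi>) = (over \<tau> \<phi> \<and> over \<tau> \<psi>)"
| "over \<tau> (Ex x \<phi>) = over \<tau> \<phi>"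
| "over \<tau> (All x \<phi>) = over \<tau> \<phi>"
| "over \<tau> (Ex2 X \<phi>) = over \<tau> \<phi>"
| "over \<tau> (All2 X \<phi>) = over \<tau> \<phi>"

text \<open>
  Structures are finite with a nonempty universe of natural numbers, so every finite structure is
  isomorphic to one of them. Values at symbols outside the vocabulary are irrelevant.
\<close>

record struct =
  univ :: "nat set"
  rel :: "rsym \<Rightarrow> nat list set"
  cst :: "csym \<Rightarrow> nat"

definition tuples :: "nat set \<Rightarrow> nat \<Rightarrow> nat list set" where
  "tuples U k = {as. length as = k \<and> set as \<subseteq> U}"

definition Str :: "vocab \<Rightarrow> struct set" where
  "Str \<tau> = {A. finite (univ A) \<and> univ A \<noteq> {} \<and>
              (\<forall>R\<in>rels \<tau>. rel A R \<subseteq> tuples (univ A) (arity R)) \<and>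
              (\<forall>c\<in>csts \<tau>. cst A c \<in> univ A)}"

definition isomorphic :: "vocab \<Rightarrow> struct \<Rightarrow> struct \<Rightarrow> bool" where
  "isomorphic \<tau> A B \<longleftrightarrow>
     (\<exists>f. bij_betw f (univ A) (univ B) \<and>
          (\<forall>R\<in>rels \<tau>. \<forall>as\<in>tuples (univ A) (arity R). as \<in> rel A R \<longleftrightarrow> map f as \<in> rel B R) \<and>
          (\<forall>c\<in>csts \<tau>. f (cst A c) = cst B c))"

primrec tval :: "struct \<Rightarrow> (nat \<Rightarrow> nat) \<Rightarrow> tm \<Rightarrow> nat" where
  "tval A s (Var x) = s x"
| "tval A s (Const c) = cst A c"

primrec sat :: "struct \<Rightarrow> (nat \<Rightarrow> nat) \<Rightarrow> (rvar \<Rightarrow> nat list set) \<Rightarrow> form \<Rightarrow> bool" where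
  "sat A s e (Eq t u) = (tval A s t = tval A s u)"
| "sat A s e (Rel R ts) = (map (tval A s) ts \<in> rel A R)"
| "sat A s e (RVar X ts) = (map (tval A s) ts \<in> e X)"
| "sat A s e (Neg \<phi>) = (\<not> sat A s e \<phi>)"
| "sat A s e (Conj \<phi> \<psi>) = (sat A s e \<phi> \<and> sat A s e \<psi>)"
| "sat A s e (Disj \<phi> \<psi>) = (sat A s e \<phi> \<or> sat A s e \<psi>)"
| "sat A s e (Ex x \<phi>) = (\<exists>a\<in>univ A. sat A (s(x := a)) e \<phi>)"
| "sat A s e (All x \<phi>) = (\<forall>a\<in>univ A. sat A (s(x := a)) e \<phi>)"
| "sat A s e (Ex2 X \<phi>) = (\<exists>V\<subseteq>tuples (univ A) (snd X). sat A s (e(X := V)) \<phi>)"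
| "sat A s e (All2 X \<phi>) = (\<forall>V\<subseteq>tuples (univ A) (snd X). sat A s (e(X := V)) \<phi>)"

text \<open>
  \<open>holds A \<phi> as\<close> is the truth of a formula without free relation variables whose free variables
  are among \<open>0, \<dots>, length as - 1\<close>, where variable \<open>i\<close> denotes the \<open>i\<close>-th entry of \<open>as\<close>.
\<close>

definition holds :: "struct \<Rightarrow> form \<Rightarrow> nat list \<Rightarrow> bool" where
  "holds A \<phi> as = sat A (nth as) (\<lambda>_. {}) \<phi>"

abbreviation models :: "struct \<Rightarrow> form \<Rightarrow> bool" where
  "models A \<phi> \<equiv> holds A \<phi> []"

definition equivalent :: "vocab \<Rightarrow> form \<Rightarrow> form \<Rightarrow> bool" where
  "equivalent \<tau> \<phi> \<psi> \<longleftrightarrow>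
     (\<forall>A\<in>Str \<tau>. \<forall>s e. range s \<subseteq> univ A \<longrightarrow> (\<forall>X. e X \<subseteq> tuples (univ A) (snd X)) \<longrightarrow>
        sat A s e \<phi> = sat A s e \<psi>)"


section \<open>Renaming and substitution\<close>

primrec rename_tm :: "(csym \<Rightarrow> csym) \<Rightarrow> tm \<Rightarrow> tm" where
  "rename_tm \<kappa> (Var x) = Var x"
| "rename_tm \<kappa> (Const c) = Const (\<kappa> c)"

primrec rename :: "(rsym \<Rightarrow> rsym) \<Rightarrow> (csym \<Rightarrow> csym) \<Rightarrow> form \<Rightarrow> form" where
  "rename \<rho> \<kappa> (Eq t u) = Eq (rename_tm \<kappa> t) (rename_tm \<kappa> u)"
| "rename \<rho> \<kappa> (Rel R ts) = Rel (\<rho> R) (map (rename_tm \<kappa>) ts)"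
| "rename \<rho> \<kappa> (RVar X ts) = RVar X (map (rename_tm \<kappa>) ts)"
| "rename \<rho> \<kappa> (Neg \<phi>) = Neg (rename \<rho> \<kappa> \<phi>)"
| "rename \<rho> \<kappa> (Conj \<phi> \<psi>) = Conj (rename \<rho> \<kappa> \<phi>) (rename \<rho> \<kappa> \<psi>)"
| "rename \<rho> \<kappa> (Disj \<phi> \<psi>) = Disj (rename \<rho> \<kappa> \<phi>) (rename \<rho> \<kappa> \<psi>)"
| "rename \<rho> \<kappa> (Ex x \<phi>) = Ex x (rename \<rho> \<kappa> \<phi>)"
| "rename \<rho> \<kappa> (All x \<phi>) = All x (rename \<rho> \<kappa> \<phi>)"
| "rename \<rho> \<kappa> (Ex2 X \<phi>) = Ex2 X (rename \<rho> \<kappa> \<phi>)"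
| "rename \<rho> \<kappa> (All2 X \<phi>) = All2 X (rename \<rho> \<kappa> \<phi>)"

definition fresh :: "(nat \<Rightarrow> tm) \<Rightarrow> nat set \<Rightarrow> nat" where
  "fresh s V = (LEAST y. y \<notin> (\<Union>x\<in>V. tm_vars (s x)))"

text \<open>Capture-avoiding substitution of terms for first-order variables.\<close>

primrec tm_subst :: "(nat \<Rightarrow> tm) \<Rightarrow> tm \<Rightarrow> tm" where
  "tm_subst s (Var x) = s x"
| "tm_subst s (Const c) = Const c"

primrec subst :: "(nat \<Rightarrow> tm) \<Rightarrow> form \<Rightarrow> form" where
  "subst s (Eq t u) = Eq (tm_subst s t) (tm_subst s u)"
| "subst s (Rel R ts) = Rel R (map (tm_subst s) ts)"
| "subst s (RVar X ts) = RVar X (map (tm_subst s) ts)"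
| "subst s (Neg \<phi>) = Neg (subst s \<phi>)"
| "subst s (Conj \<phi> \<psi>) = Conj (subst s \<phi>) (subst s \<psi>)"
| "subst s (Disj \<phi> \<psi>) = Disj (subst s \<phi>) (subst s \<psi>)"
| "subst s (Ex x \<phi>) =
     (let y = fresh s (fv \<phi> - {x}) in Ex y (subst (s(x := Var y)) \<phi>))"
| "subst s (All x \<phi>) =
     (let y = fresh s (fv \<phi> - {x}) in All y (subst (s(x := Var y)) \<phi>))"
| "subst s (Ex2 X \<phi>) = Ex2 X (subst s \<phi>)"
| "subst s (All2 X \<phi>) = All2 X (subst s \<phi>)"

text \<open>\<open>inst \<phi> ts\<close> is \<open>\<phi>(t\<^sub>0, \<dots>, t\<^sub>k\<^sub>-\<^sub>1)\<close>, for \<open>\<phi>\<close> with free variables among \<open>0, \<dots>, k - 1\<close>.\<close>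

definition inst :: "form \<Rightarrow> tm list \<Rightarrow> form" where
  "inst \<phi> ts = subst (\<lambda>i. if i < length ts then ts ! i else Var i) \<phi>"

text \<open>
  Substitution of \<open>S R\<close>, a formula with parameters \<open>0, \<dots>, arity R - 1\<close> and no other free variables,
  for each relation symbol \<open>R\<close>.
\<close>

primrec rel_subst :: "(rsym \<Rightarrow> form) \<Rightarrow> form \<Rightarrow> form" where
  "rel_subst S (Eq t u) = Eq t u"
| "rel_subst S (Rel R ts) = inst (S R) ts"
| "rel_subst S (RVar X ts) = RVar X ts"
| "rel_subst S (Neg \<phi>) = Neg (rel_subst S \<phi>)"
| "rel_subst S (Conj \<phi> \<psi>) = Conj (rel_subst S \<phi>) (rel_subst S \<psi>)"
| "rel_subst S (Disj \<phi> \<psi>) = Disj (rel_subst S \<phi>) (rel_subst S \<psi>)"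
| "rel_subst S (Ex x \<phi>) = Ex x (rel_subst S \<phi>)"
| "rel_subst S (All x \<phi>) = All x (rel_subst S \<phi>)"
| "rel_subst S (Ex2 X \<phi>) = Ex2 X (rel_subst S \<phi>)"
| "rel_subst S (All2 X \<phi>) = All2 X (rel_subst S \<phi>)"


section \<open>Fragments of second-order logic\<close>

definition Lang :: "form set \<Rightarrow> vocab \<Rightarrow> form set" where
  "Lang L \<tau> = {\<phi>\<in>L. over \<tau> \<phi>}"

definition param_form :: "form set \<Rightarrow> vocab \<Rightarrow> nat \<Rightarrow> form \<Rightarrow> bool" where
  "param_form L \<tau> k \<phi> \<longleftrightarrow> \<phi> \<in> Lang L \<tau> \<and> fv \<phi> \<subseteq> {..<k} \<and> frv \<phi> = {}"

abbreviation sentence :: "form set \<Rightarrow> vocab \<Rightarrow> form \<Rightarrow> bool" where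
  "sentence L \<tau> \<phi> \<equiv> param_form L \<tau> 0 \<phi>"

locale fragment =
  fixes L :: "form set" and qr :: "form \<Rightarrow> nat"
  assumes Eq_closed: "vocabulary \<tau> \<Longrightarrow> over \<tau> (Eq t u) \<Longrightarrow> Eq t u \<in> L"
    and Rel_closed: "vocabulary \<tau> \<Longrightarrow> over \<tau> (Rel R ts) \<Longrightarrow> Rel R ts \<in> L"
    and Neg_closed: "vocabulary \<tau> \<Longrightarrow> \<phi> \<in> Lang L \<tau> \<Longrightarrow> Neg \<phi> \<in> L"
    and Conj_closed: "vocabulary \<tau> \<Longrightarrow> \<phi> \<in> Lang L \<tau> \<Longrightarrow> \<psi> \<in> Lang L \<tau> \<Longrightarrow> Conj \<phi> \<psi> \<in> L"
    and Disj_closed: "vocabulary \<tau> \<Longrightarrow> \<phi> \<in> Lang L \<tau> \<Longrightarrow> \<psi> \<in> Lang L \<tau> \<Longrightarrow> Disj \<phi> \<psi> \<in> L"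
    and rename_closed: "vocabulary \<tau> \<Longrightarrow> \<phi> \<in> Lang L \<tau> \<Longrightarrow>
      inj_on \<rho> (rels \<tau>) \<Longrightarrow> (\<forall>R\<in>rels \<tau>. arity (\<rho> R) = arity R) \<Longrightarrow> inj_on \<kappa> (csts \<tau>) \<Longrightarrow>
      rename \<rho> \<kappa> \<phi> \<in> L"
    and qr_atomic: "vocabulary \<tau> \<Longrightarrow> \<phi> \<in> Lang L \<tau> \<Longrightarrow> atomic \<phi> \<Longrightarrow> qr \<phi> = 0"
    and qr_Neg: "vocabulary \<tau> \<Longrightarrow> \<phi> \<in> Lang L \<tau> \<Longrightarrow> qr (Neg \<phi>) = qr \<phi>"
    and qr_Conj: "vocabulary \<tau> \<Longrightarrow> \<phi> \<in> Lang L \<tau> \<Longrightarrow> \<psi> \<in> Lang L \<tau> \<Longrightarrow>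
      qr (Conj \<phi> \<psi>) = max (qr \<phi>) (qr \<psi>)"
    and qr_Disj: "vocabulary \<tau> \<Longrightarrow> \<phi> \<in> Lang L \<tau> \<Longrightarrow> \<psi> \<in> Lang L \<tau> \<Longrightarrow>
      qr (Disj \<phi> \<psi>) = max (qr \<phi>) (qr \<psi>)"
    and qr_rel_subst: "vocabulary \<sigma> \<Longrightarrow> vocabulary \<tau> \<Longrightarrow> csts \<sigma> \<subseteq> csts \<tau> \<Longrightarrow> \<theta> \<in> Lang L \<sigma> \<Longrightarrow>
      (\<forall>R\<in>rels \<sigma>. param_form L \<tau> (arity R) (S R) \<and> qr (S R) \<le> m) \<Longrightarrow>
      rel_subst S \<theta> \<in> Lang L \<tau> \<Longrightarrow> qr (rel_subst S \<theta>) \<le> qr \<theta> + m"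
    and finitely_many: "vocabulary \<tau> \<Longrightarrow> finite V \<Longrightarrow> finite W \<Longrightarrow>
      \<exists>F. finite F \<and>
        (\<forall>\<phi>\<in>Lang L \<tau>. qr \<phi> \<le> q \<and> fv \<phi> = V \<and> frv \<phi> = W \<longrightarrow> (\<exists>\<psi>\<in>F. equivalent \<tau> \<phi> \<psi>))"
    and Ex_equivalent: "vocabulary \<tau> \<Longrightarrow> \<phi> \<in> Lang L \<tau> \<Longrightarrow> \<exists>\<psi>\<in>Lang L \<tau>. equivalent \<tau> (Ex x \<phi>) \<psi>"


section \<open>Scalar transductions\<close>

text \<open>
  Constant symbols of the target vocabulary are interpreted by constant symbols of the source
  vocabulary.
\<close>

record transd =
  t_univ :: form
  t_rel :: "rsym \<Rightarrow> form"
  t_cst :: "csym \<Rightarrow> csym"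

definition transduction :: "form set \<Rightarrow> vocab \<Rightarrow> vocab \<Rightarrow> transd \<Rightarrow> bool" where
  "transduction L \<tau> \<sigma> \<Phi> \<longleftrightarrow>
     param_form L \<tau> 1 (t_univ \<Phi>) \<and>
     (\<forall>R\<in>rels \<sigma>. param_form L \<tau> (arity R) (t_rel \<Phi> R)) \<and>
     (\<forall>c\<in>csts \<sigma>. t_cst \<Phi> c \<in> csts \<tau>)"

definition star :: "transd \<Rightarrow> struct \<Rightarrow> struct" where
  "star \<Phi> A =
     (let U = {a\<in>univ A. holds A (t_univ \<Phi>) [a]} in
      \<lparr>univ = U,
       rel = (\<lambda>R. {as\<in>tuples U (arity R). holds A (t_rel \<Phi> R) as}),
       cst = (\<lambda>c. cst A (t_cst \<Phi> c))\<rparr>)"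

text \<open>
  The backward translation replaces relation symbols by their defining formulas and relativizes
  first-order quantifiers to the new universe. Relation quantifiers need no relativization,
  because a relation variable is only ever applied to elements of the new universe.
\<close>

primrec sharp :: "transd \<Rightarrow> form \<Rightarrow> form" where
  "sharp \<Phi> (Eq t u) = Eq (rename_tm (t_cst \<Phi>) t) (rename_tm (t_cst \<Phi>) u)"
| "sharp \<Phi> (Rel R ts) = inst (t_rel \<Phi> R) (map (rename_tm (t_cst \<Phi>)) ts)"
| "sharp \<Phi> (RVar X ts) = RVar X (map (rename_tm (t_cst \<Phi>)) ts)"
| "sharp \<Phi> (Neg \<phi>) = Neg (sharp \<Phi> \<phi>)"
| "sharp \<Phi> (Conj \<phi> \<psi>) = Conj (sharp \<Phi> \<phi>) (sharp \<Phi> \<psi>)"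
| "sharp \<Phi> (Disj \<phi> \<psi>) = Disj (sharp \<Phi> \<phi>) (sharp \<Phi> \<psi>)"
| "sharp \<Phi> (Ex x \<phi>) = Ex x (Conj (inst (t_univ \<Phi>) [Var x]) (sharp \<Phi> \<phi>))"
| "sharp \<Phi> (All x \<phi>) = All x (Imp (inst (t_univ \<Phi>) [Var x]) (sharp \<Phi> \<phi>))"
| "sharp \<Phi> (Ex2 X \<phi>) = Ex2 X (sharp \<Phi> \<phi>)"
| "sharp \<Phi> (All2 X \<phi>) = All2 X (sharp \<Phi> \<phi>)"

locale tame_fragment = fragment +
  assumes sharp_closed: "vocabulary \<tau> \<Longrightarrow> vocabulary \<sigma> \<Longrightarrow> transduction L \<tau> \<sigma> \<Phi> \<Longrightarrow>
      \<theta> \<in> Lang L \<sigma> \<Longrightarrow> sharp \<Phi> \<theta> \<in> Lang L \<tau>"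
    and All_Imp_closed: "vocabulary \<tau> \<Longrightarrow> \<phi> \<in> Lang L \<tau> \<Longrightarrow> \<psi> \<in> Lang L \<tau> \<Longrightarrow>
      All x (Imp \<phi> \<psi>) \<in> L"


section \<open>Rich disjoint union, smooth and sum-like operations\<close>

definition rich_vocab :: "vocab \<Rightarrow> vocab" where
  "rich_vocab \<tau> = \<lparr>rels = RIn ` rels \<tau> \<union> {PLeft, PRight}, csts = CLeft ` csts \<tau> \<union> CRight ` csts \<tau>\<rparr>"

abbreviation inl :: "nat \<Rightarrow> nat" where "inl a \<equiv> sum_encode (Inl a)"

abbreviation inr :: "nat \<Rightarrow> nat" where "inr a \<equiv> sum_encode (Inr a)"

primrec rich_rel :: "struct \<Rightarrow> struct \<Rightarrow> rsym \<Rightarrow> nat list set" where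
  "rich_rel A B (RSym n k) = {}"
| "rich_rel A B (RIn R) = map inl ` rel A R \<union> map inr ` rel B R"
| "rich_rel A B PLeft = {[inl a] | a. a \<in> univ A}"
| "rich_rel A B PRight = {[inr b] | b. b \<in> univ B}"

primrec rich_cst :: "struct \<Rightarrow> struct \<Rightarrow> csym \<Rightarrow> nat" where
  "rich_cst A B (CSym n) = undefined"
| "rich_cst A B (CLeft c) = inl (cst A c)"
| "rich_cst A B (CRight c) = inr (cst B c)"

definition rich_union :: "struct \<Rightarrow> struct \<Rightarrow> struct" where
  "rich_union A B =
     \<lparr>univ = inl ` univ A \<union> inr ` univ B, rel = rich_rel A B, cst = rich_cst A B\<rparr>"

definition q_equiv :: "form set \<Rightarrow> (form \<Rightarrow> nat) \<Rightarrow> vocab \<Rightarrow> nat \<Rightarrow> struct \<Rightarrow> struct \<Rightarrow> bool" where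
  "q_equiv L qr \<tau> q A B \<longleftrightarrow>
     (\<forall>\<phi>. sentence L \<tau> \<phi> \<and> qr \<phi> \<le> q \<longrightarrow> models A \<phi> = models B \<phi>)"

text \<open>\<open>opn\<close> maps pairs of \<open>\<tau>\<close>-structures to \<open>\<sigma>\<close>-structures.\<close>

definition smooth ::
  "form set \<Rightarrow> (form \<Rightarrow> nat) \<Rightarrow> vocab \<Rightarrow> vocab \<Rightarrow> (struct \<Rightarrow> struct \<Rightarrow> struct) \<Rightarrow> bool" where
  "smooth L qr \<tau> \<sigma> opn \<longleftrightarrow>
     (\<forall>q. \<forall>A1\<in>Str \<tau>. \<forall>A2\<in>Str \<tau>. \<forall>B1\<in>Str \<tau>. \<forall>B2\<in>Str \<tau>.
        q_equiv L qr \<tau> q A1 B1 \<longrightarrow> q_equiv L qr \<tau> q A2 B2 \<longrightarrow>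
        q_equiv L qr \<sigma> q (opn A1 A2) (opn B1 B2))"

definition rich_union_smooth :: "form set \<Rightarrow> (form \<Rightarrow> nat) \<Rightarrow> bool" where
  "rich_union_smooth L qr \<longleftrightarrow>
     (\<forall>\<tau>. vocabulary \<tau> \<longrightarrow> smooth L qr \<tau> (rich_vocab \<tau>) rich_union)"

text \<open>Disjoint unions being defined up to isomorphism, so is the equation for a sum-like operation.\<close>

definition sum_like :: "form set \<Rightarrow> vocab \<Rightarrow> (struct \<Rightarrow> struct \<Rightarrow> struct) \<Rightarrow> bool" where
  "sum_like L \<tau> opn \<longleftrightarrow>
     (\<exists>\<Phi>. transduction L (rich_vocab \<tau>) \<tau> \<Phi> \<and>
        (\<forall>A\<in>Str \<tau>. \<forall>B\<in>Str \<tau>. isomorphic \<tau> (opn A B) (star \<Phi> (rich_union A B))))"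


section \<open>Polynomials definable in a fragment\<close>

text \<open>
  \<open>ProdC a \<phi> t\<close> is the product of \<open>t\<close> over all interpretations of the constant \<open>a\<close> satisfying \<open>\<phi>\<close>;
  \<open>SumC as \<phi> p\<close> and \<open>SumR Rs \<phi> p\<close> are the sums of \<open>p\<close> over all interpretations of the constants
  \<open>as\<close>, respectively of the relation symbols \<open>Rs\<close>, satisfying \<open>\<phi>\<close>.
\<close>

datatype 'x smono = Num nat | Ind 'x

datatype 'x mono = Simple "'x smono" | ProdC csym form "'x smono" | Times "'x mono" "'x mono"

datatype 'x lpoly = Mono "'x mono" | SumC "csym list" form "'x lpoly" | SumR "rsym list" form "'x lpoly"

definition add_csts :: "vocab \<Rightarrow> csym list \<Rightarrow> vocab" where
  "add_csts \<tau> cs = \<tau>\<lparr>csts := csts \<tau> \<union> set cs\<rparr>"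

definition add_rels :: "vocab \<Rightarrow> rsym list \<Rightarrow> vocab" where
  "add_rels \<tau> Rs = \<tau>\<lparr>rels := rels \<tau> \<union> set Rs\<rparr>"

primrec is_mono :: "form set \<Rightarrow> vocab \<Rightarrow> 'x mono \<Rightarrow> bool" where
  "is_mono L \<tau> (Simple t) = True"
| "is_mono L \<tau> (ProdC a \<phi> t) = (a \<notin> csts \<tau> \<and> sentence L (add_csts \<tau> [a]) \<phi>)"
| "is_mono L \<tau> (Times m n) = (is_mono L \<tau> m \<and> is_mono L \<tau> n)"

text \<open>
  Summation is over elements and over relations of arity at most one (sets). The arity bound is
  indispensable: every tame fragment can express that a binary relation is a linear order, and
  the sum of \<open>1\<close> over all linear orders of the universe is the factorial of its size, for which
  the connection matrix of the disjoint union has infinite rank.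
\<close>

primrec is_lpoly :: "form set \<Rightarrow> vocab \<Rightarrow> 'x lpoly \<Rightarrow> bool" where
  "is_lpoly L \<tau> (Mono m) = is_mono L \<tau> m"
| "is_lpoly L \<tau> (SumC cs \<phi> p) =
     (distinct cs \<and> set cs \<inter> csts \<tau> = {} \<and>
      sentence L (add_csts \<tau> cs) \<phi> \<and> is_lpoly L (add_csts \<tau> cs) p)"
| "is_lpoly L \<tau> (SumR Rs \<phi> p) =
     (distinct Rs \<and> set Rs \<inter> rels \<tau> = {} \<and> (\<forall>R\<in>set Rs. arity R \<le> 1) \<and>
      sentence L (add_rels \<tau> Rs) \<phi> \<and> is_lpoly L (add_rels \<tau> Rs) p)"

text \<open>The polynomial ring \<open>\<rat>[X]\<close> and its field of fractions \<open>\<rat>(X)\<close>, where \<open>X\<close> is the type \<open>'x\<close>.\<close>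

type_synonym 'x mpoly = "('x \<Rightarrow>\<^sub>0 nat) \<Rightarrow>\<^sub>0 rat"

type_synonym 'x ratfun = "'x mpoly fract"

definition set_csts :: "struct \<Rightarrow> csym list \<Rightarrow> nat list \<Rightarrow> struct" where
  "set_csts M cs as = M\<lparr>cst := (\<lambda>c. case map_of (zip cs as) c of None \<Rightarrow> cst M c | Some a \<Rightarrow> a)\<rparr>"

definition set_rels :: "struct \<Rightarrow> rsym list \<Rightarrow> nat list set list \<Rightarrow> struct" where
  "set_rels M Rs Vs = M\<lparr>rel := (\<lambda>R. case map_of (zip Rs Vs) R of None \<Rightarrow> rel M R | Some V \<Rightarrow> V)\<rparr>"

definition rel_tuples :: "nat set \<Rightarrow> rsym list \<Rightarrow> nat list set list set" where
  "rel_tuples U Rs = {Vs. list_all2 (\<lambda>R V. V \<subseteq> tuples U (arity R)) Rs Vs}"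

primrec smono_val :: "'x::linorder smono \<Rightarrow> 'x mpoly" where
  "smono_val (Num n) = of_nat n"
| "smono_val (Ind x) = Poly_Mapping.single (Poly_Mapping.single x 1) 1"

primrec mono_val :: "struct \<Rightarrow> 'x::linorder mono \<Rightarrow> 'x mpoly" where
  "mono_val M (Simple t) = smono_val t"
| "mono_val M (ProdC a \<phi> t) = (\<Prod>x\<in>{x\<in>univ M. models (set_csts M [a] [x]) \<phi>}. smono_val t)"
| "mono_val M (Times m n) = mono_val M m * mono_val M n"

primrec lpoly_val :: "struct \<Rightarrow> 'x::linorder lpoly \<Rightarrow> 'x mpoly" where
  "lpoly_val M (Mono m) = mono_val M m"
| "lpoly_val M (SumC cs \<phi> p) =
     (\<Sum>as\<in>{as\<in>tuples (univ M) (length cs). models (set_csts M cs as) \<phi>}.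
        lpoly_val (set_csts M cs as) p)"
| "lpoly_val M (SumR Rs \<phi> p) =
     (\<Sum>Vs\<in>{Vs\<in>rel_tuples (univ M) Rs. models (set_rels M Rs Vs) \<phi>}.
        lpoly_val (set_rels M Rs Vs) p)"


section \<open>Connection matrices and rank\<close>

definition connection_matrix ::
  "(struct \<Rightarrow> struct \<Rightarrow> struct) \<Rightarrow> 'x::linorder lpoly \<Rightarrow> struct \<Rightarrow> struct \<Rightarrow> 'x ratfun" where
  "connection_matrix opn P A B = Fract (lpoly_val (opn A B) P) 1"

text \<open>
  The rank of a possibly infinite matrix \<open>M\<close> with rows indexed by \<open>I\<close> and columns by \<open>J\<close> is the
  supremum of the sizes of the finite linearly independent sets of rows.
\<close>

definition matrix_row :: "'j set \<Rightarrow> ('i \<Rightarrow> 'j \<Rightarrow> 'k::field) \<Rightarrow> 'i \<Rightarrow> 'j \<Rightarrow> 'k" where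
  "matrix_row J M i = (\<lambda>j. if j \<in> J then M i j else 0)"

definition lin_dependent :: "('j \<Rightarrow> 'k::field) set \<Rightarrow> bool" where
  "lin_dependent = module.dependent (\<lambda>c v j. c * v j)"

definition matrix_rank :: "'i set \<Rightarrow> 'j set \<Rightarrow> ('i \<Rightarrow> 'j \<Rightarrow> 'k::field) \<Rightarrow> enat" where
  "matrix_rank I J M =
     (SUP S\<in>{S. S \<subseteq> matrix_row J M ` I \<and> finite S \<and> \<not> lin_dependent S}. enat (card S))"

end

theory Submission
  imports Defs
begin

text \<open>
  Call a function of two structures separable if it is a finite sum of products \<open>f A * g B\<close>; the
  rows of the matrix of a separable function lie in the span of the finitely many \<open>g\<close>. We show by
  induction on \<open>P\<close> that the value of \<open>P\<close> in \<open>\<Phi>\<^sup>\<star>(A \<squnion> B)\<close> is separable. By tameness and smoothness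
  the truth of a sentence in \<open>\<Phi>\<^sup>\<star>(A \<squnion> B)\<close> depends only on the types of \<open>A\<close> and \<open>B\<close> of some
  quantifier rank, of which there are finitely many, so its indicator function is separable. The sum
  over an element \<open>a\<close> of \<open>\<Phi>\<^sup>\<star>(A \<squnion> B)\<close> splits according to whether \<open>a\<close> lies in \<open>A\<close> or in \<open>B\<close>, and
  the sum over a set splits into a double sum over a subset of \<open>A\<close> and a subset of \<open>B\<close>. In both
  cases the expansion of \<open>\<Phi>\<^sup>\<star>(A \<squnion> B)\<close> is a transduction of the rich union of an expansion of \<open>A\<close>
  and an expansion of \<open>B\<close>. To keep both over the same vocabulary, the new constant is interpreted by
  a dummy element in the part that does not contain \<open>a\<close>.
\<close>

section \<open>Semantics of second-order formulas\<close>

lemma finite_tm_vars: "finite (tm_vars t)"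
  by (cases t) auto

lemma finite_fv: "finite (fv \<phi>)"
  by (induction \<phi>) (auto simp: finite_tm_vars)

lemma tval_cong: "\<forall>x\<in>tm_vars t. s x = s' x \<Longrightarrow> tval A s t = tval A s' t"
  by (cases t) auto

lemma sat_cong:
  assumes "\<forall>x\<in>fv \<phi>. s x = s' x" and "\<forall>X\<in>frv \<phi>. e X = e' X"
  shows "sat A s e \<phi> = sat A s' e' \<phi>"
  using assms
proof (induction \<phi> arbitrary: s s' e e')
  case (Eq t u)
  then show ?case by (simp add: ball_Un tval_cong[of t s s'] tval_cong[of u s s'])
next
  case (Rel R ts)
  then have "map (tval A s) ts = map (tval A s') ts" by (simp add: tval_cong)
  then show ?case by (simp del: map_eq_conv)
next
  case (RVar X ts)
  then have "map (tval A s) ts = map (tval A s') ts" by (simp add: tval_cong)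
  then show ?case using RVar.prems by (simp del: map_eq_conv)
next
  case (Neg \<phi>)
  show ?case using Neg.prems Neg.IH[of s s' e e'] by simp
next
  case (Conj \<phi> \<psi>)
  show ?case using Conj.prems Conj.IH(1)[of s s' e e'] Conj.IH(2)[of s s' e e'] by auto
next
  case (Disj \<phi> \<psi>)
  show ?case using Disj.prems Disj.IH(1)[of s s' e e'] Disj.IH(2)[of s s' e e'] by auto
next
  case (Ex x \<phi>)
  then have "sat A (s(x := a)) e \<phi> = sat A (s'(x := a)) e' \<phi>" for a by (intro Ex.IH) auto
  then show ?case by simp
next
  case (All x \<phi>)
  then have "sat A (s(x := a)) e \<phi> = sat A (s'(x := a)) e' \<phi>" for a by (intro All.IH) auto
  then show ?case by simp
next
  case (Ex2 X \<phi>)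
  then have "sat A s (e(X := V)) \<phi> = sat A s' (e'(X := V)) \<phi>" for V by (intro Ex2.IH) auto
  then show ?case by simp
next
  case (All2 X \<phi>)
  then have "sat A s (e(X := V)) \<phi> = sat A s' (e'(X := V)) \<phi>" for V by (intro All2.IH) auto
  then show ?case by simp
qed

lemma fresh_notin_tm_vars:
  assumes "finite V" "z \<in> V"
  shows "fresh \<sigma> V \<notin> tm_vars (\<sigma> z)"
proof -
  have "finite (\<Union>x\<in>V. tm_vars (\<sigma> x))" using assms(1) by (simp add: finite_tm_vars)
  then have "\<exists>y. y \<notin> (\<Union>x\<in>V. tm_vars (\<sigma> x))" by (rule ex_new_if_finite[OF infinite_UNIV_nat])
  from LeastI_ex[OF this] show ?thesis using assms(2) by (auto simp: fresh_def)
qed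

lemma tval_tm_subst: "tval A s (tm_subst \<sigma> t) = tval A (\<lambda>x. tval A s (\<sigma> x)) t"
  by (cases t) auto

lemma tval_fresh_upd:
  assumes "y = fresh \<sigma> (V - {x})" "finite V" "z \<in> V"
  shows "tval A (s(y := a)) ((\<sigma>(x := Var y)) z) = ((\<lambda>z. tval A s (\<sigma> z))(x := a)) z"
proof (cases "z = x")
  case False
  then have "y \<notin> tm_vars (\<sigma> z)" using assms by (simp add: fresh_notin_tm_vars)
  then have "tval A (s(y := a)) (\<sigma> z) = tval A s (\<sigma> z)" by (intro tval_cong) auto
  then show ?thesis using False by simp
qed simp

lemma sat_subst: "sat A s e (subst \<sigma> \<phi>) = sat A (\<lambda>x. tval A s (\<sigma> x)) e \<phi>"
proof (induction \<phi> arbitrary: s e \<sigma>)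
  case (Ex x \<phi>)
  define y where "y = fresh \<sigma> (fv \<phi> - {x})"
  have "sat A (s(y := a)) e (subst (\<sigma>(x := Var y)) \<phi>) = sat A ((\<lambda>x. tval A s (\<sigma> x))(x := a)) e \<phi>"
    for a
    unfolding Ex.IH by (intro sat_cong ballI tval_fresh_upd[OF y_def finite_fv] refl)
  then show ?case by (simp add: Let_def flip: y_def)
next
  case (All x \<phi>)
  define y where "y = fresh \<sigma> (fv \<phi> - {x})"
  have "sat A (s(y := a)) e (subst (\<sigma>(x := Var y)) \<phi>) = sat A ((\<lambda>x. tval A s (\<sigma> x))(x := a)) e \<phi>"
    for a
    unfolding All.IH by (intro sat_cong ballI tval_fresh_upd[OF y_def finite_fv] refl)
  then show ?case by (simp add: Let_def flip: y_def)
qed (simp_all add: tval_tm_subst comp_def)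

lemma sat_inst:
  assumes "fv \<phi> \<subseteq> {..<length ts}" "frv \<phi> = {}"
  shows "sat A s e (inst \<phi> ts) = holds A \<phi> (map (tval A s) ts)"
  unfolding inst_def sat_subst holds_def by (rule sat_cong) (use assms in auto)

lemma tm_vars_tm_subst: "tm_vars (tm_subst \<sigma> t) = (\<Union>x\<in>tm_vars t. tm_vars (\<sigma> x))"
  by (cases t) auto

lemma fv_subst_upd_Var:
  assumes "fv (subst (\<sigma>(x := Var y)) \<phi>) \<subseteq> (\<Union>z\<in>fv \<phi>. tm_vars ((\<sigma>(x := Var y)) z))"
  shows "fv (subst (\<sigma>(x := Var y)) \<phi>) - {y} \<subseteq> (\<Union>z\<in>fv \<phi> - {x}. tm_vars (\<sigma> z))"
proof -
  have "(\<Union>z\<in>fv \<phi>. tm_vars ((\<sigma>(x := Var y)) z)) \<subseteq> {y} \<union> (\<Union>z\<in>fv \<phi> - {x}. tm_vars (\<sigma> z))"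
    by (auto split: if_splits)
  with assms show ?thesis by blast
qed

lemma fv_subst: "fv (subst \<sigma> \<phi>) \<subseteq> (\<Union>x\<in>fv \<phi>. tm_vars (\<sigma> x))"
proof (induction \<phi> arbitrary: \<sigma>)
  case (Ex x \<phi>)
  show ?case using fv_subst_upd_Var[OF Ex.IH] by (simp add: Let_def)
next
  case (All x \<phi>)
  show ?case using fv_subst_upd_Var[OF All.IH] by (simp add: Let_def)
qed (fastforce simp: tm_vars_tm_subst)+

lemma frv_subst: "frv (subst \<sigma> \<phi>) = frv \<phi>"
  by (induction \<phi> arbitrary: \<sigma>) (auto simp: Let_def)

lemma fv_inst:
  assumes "fv \<phi> \<subseteq> {..<length ts}"
  shows "fv (inst \<phi> ts) \<subseteq> (\<Union>t\<in>set ts. tm_vars t)"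
proof -
  have "fv (inst \<phi> ts) \<subseteq> (\<Union>x\<in>fv \<phi>. tm_vars (if x < length ts then ts ! x else Var x))"
    unfolding inst_def by (rule fv_subst)
  also have "\<dots> \<subseteq> (\<Union>t\<in>set ts. tm_vars t)"
  proof (rule UN_least)
    fix x assume "x \<in> fv \<phi>"
    then have "x < length ts" using assms by auto
    then show "tm_vars (if x < length ts then ts ! x else Var x) \<subseteq> (\<Union>t\<in>set ts. tm_vars t)"
      by (simp add: UN_upper)
  qed
  finally show ?thesis .
qed

lemma frv_inst: "frv (inst \<phi> ts) = frv \<phi>"
  by (simp add: inst_def frv_subst)

lemma tm_vars_rename_tm: "tm_vars (rename_tm \<kappa> t) = tm_vars t"
  by (cases t) auto

lemma param_formD:
  assumes "param_form L \<tau> k \<phi>"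
  shows "over \<tau> \<phi>" "fv \<phi> \<subseteq> {..<k}" "frv \<phi> = {}"
  using assms by (auto simp: param_form_def Lang_def)

lemma over_mono:
  assumes "rels \<tau> \<subseteq> rels \<tau>'" "csts \<tau> \<subseteq> csts \<tau>'"
  shows "over \<tau> \<phi> \<Longrightarrow> over \<tau>' \<phi>"
proof -
  have "tm_over \<tau> t \<Longrightarrow> tm_over \<tau>' t" for t using assms by (cases t) auto
  then show "over \<tau> \<phi> \<Longrightarrow> over \<tau>' \<phi>" using assms by (induction \<phi>) auto
qed

lemma param_form_mono:
  "param_form L \<tau> k \<phi> \<Longrightarrow> rels \<tau> \<subseteq> rels \<tau>' \<Longrightarrow> csts \<tau> \<subseteq> csts \<tau>' \<Longrightarrow> param_form L \<tau>' k \<phi>"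
  by (auto simp: param_form_def Lang_def intro: over_mono)


section \<open>Agreeing and isomorphic structures\<close>

definition agree :: "vocab \<Rightarrow> struct \<Rightarrow> struct \<Rightarrow> bool" where
  "agree \<tau> A B \<longleftrightarrow> univ A = univ B \<and> (\<forall>R\<in>rels \<tau>. rel A R = rel B R) \<and> (\<forall>c\<in>csts \<tau>. cst A c = cst B c)"

lemma sat_agree:
  assumes "agree \<tau> A B" "over \<tau> \<phi>"
  shows "sat A s e \<phi> = sat B s e \<phi>"
proof -
  have tval: "tval A s t = tval B s t" if "tm_over \<tau> t" for s t
    using that assms(1) by (cases t) (auto simp: agree_def)
  have map_tval: "map (tval A s) ts = map (tval B s) ts" if "\<forall>t\<in>set ts. tm_over \<tau> t" for s ts
    using that by (simp add: tval)
  show ?thesis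
    using assms(2)
  proof (induction \<phi> arbitrary: s e)
    case (Rel R ts)
    then show ?case using map_tval[of ts s] assms(1) by (simp add: agree_def del: map_eq_conv)
  next
    case (RVar X ts)
    then show ?case using map_tval[of ts s] by (simp del: map_eq_conv)
  qed (use assms(1) in \<open>auto simp: tval agree_def\<close>)
qed

lemma holds_agree: "agree \<tau> A B \<Longrightarrow> param_form L \<tau> k \<phi> \<Longrightarrow> holds A \<phi> as = holds B \<phi> as"
  by (simp add: holds_def sat_agree param_formD(1))

definition cst_closed :: "vocab \<Rightarrow> struct \<Rightarrow> bool" where
  "cst_closed \<tau> A \<longleftrightarrow> (\<forall>c\<in>csts \<tau>. cst A c \<in> univ A)"

lemma cst_closed_agree: "agree \<tau> A B \<Longrightarrow> cst_closed \<tau> A = cst_closed \<tau> B"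
  by (simp add: agree_def cst_closed_def)

lemma tval_in_univ:
  assumes "cst_closed \<tau> A" "tm_over \<tau> t" "s ` tm_vars t \<subseteq> univ A"
  shows "tval A s t \<in> univ A"
  using assms by (cases t) (auto simp: cst_closed_def)

lemma map_tval_in_tuples:
  assumes "cst_closed \<tau> A" "\<forall>t\<in>set ts. tm_over \<tau> t" "s ` (\<Union>t\<in>set ts. tm_vars t) \<subseteq> univ A"
  shows "map (tval A s) ts \<in> tuples (univ A) (length ts)"
  using assms by (auto simp: tuples_def image_UN intro!: tval_in_univ)

definition isomorphism :: "vocab \<Rightarrow> (nat \<Rightarrow> nat) \<Rightarrow> struct \<Rightarrow> struct \<Rightarrow> bool" where
  "isomorphism \<tau> f A B \<longleftrightarrow>
     bij_betw f (univ A) (univ B) \<and>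
     (\<forall>R\<in>rels \<tau>. \<forall>as\<in>tuples (univ A) (arity R). as \<in> rel A R \<longleftrightarrow> map f as \<in> rel B R) \<and>
     (\<forall>c\<in>csts \<tau>. f (cst A c) = cst B c)"

lemma isomorphic_iff_isomorphism: "isomorphic \<tau> A B \<longleftrightarrow> (\<exists>f. isomorphism \<tau> f A B)"
  by (simp add: isomorphic_def isomorphism_def)

lemma isomorphism_bij: "isomorphism \<tau> f A B \<Longrightarrow> bij_betw f (univ A) (univ B)"
  by (simp add: isomorphism_def)

lemma isomorphism_id: "agree \<tau> A B \<Longrightarrow> isomorphism \<tau> id A B"
  by (simp add: isomorphism_def agree_def)

lemma cst_closed_isomorphism: "isomorphism \<tau> f A B \<Longrightarrow> cst_closed \<tau> A \<Longrightarrow> cst_closed \<tau> B"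
  unfolding isomorphism_def cst_closed_def by (metis bij_betwE)

lemma tuples_eq_lists: "tuples U k = {as \<in> lists U. length as = k}"
  by (auto simp: tuples_def)

lemma bij_betw_tuples:
  assumes "bij_betw f U W"
  shows "bij_betw (map f) (tuples U k) (tuples W k)"
proof (rule bij_betw_subset[OF bij_lists[OF assms]])
  have "lists W = map f ` lists U" using bij_betw_imp_surj_on[OF bij_lists[OF assms]] ..
  then show "map f ` tuples U k = tuples W k" by (auto simp: tuples_eq_lists)
qed (auto simp: tuples_eq_lists)

lemma map_in_image_map_iff:
  fixes f :: "nat \<Rightarrow> nat"
  assumes "bij_betw f U W" "V \<subseteq> tuples U k" "as \<in> tuples U k"
  shows "map f as \<in> map f ` V \<longleftrightarrow> as \<in> V"
  using bij_betw_imp_inj_on[OF bij_betw_tuples[OF assms(1)]] assms(3,2)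
  by (rule inj_on_image_mem_iff)

lemma tval_isomorphism:
  "isomorphism \<tau> f A B \<Longrightarrow> tm_over \<tau> t \<Longrightarrow> tval B (\<lambda>x. f (s x)) t = f (tval A s t)"
  by (cases t) (auto simp: isomorphism_def)

lemma map_tval_isomorphism:
  "isomorphism \<tau> f A B \<Longrightarrow> \<forall>t\<in>set ts. tm_over \<tau> t \<Longrightarrow>
    map (tval B (\<lambda>x. f (s x))) ts = map f (map (tval A s) ts)"
  by (simp add: tval_isomorphism)

lemma sat_isomorphism:
  assumes iso: "isomorphism \<tau> f A B" and closed: "cst_closed \<tau> A" and "over \<tau> \<phi>"
    and "s ` fv \<phi> \<subseteq> univ A" and "\<forall>X. e X \<subseteq> tuples (univ A) (snd X)"
  shows "sat B (\<lambda>x. f (s x)) (\<lambda>X. map f ` e X) \<phi> = sat A s e \<phi>"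
proof -
  note bij = isomorphism_bij[OF iso]
  have univ: "univ B = f ` univ A" and tuples: "tuples (univ B) k = map f ` tuples (univ A) k" for k
    using bij_betw_imp_surj_on[OF bij] bij_betw_imp_surj_on[OF bij_betw_tuples[OF bij]] by auto
  note map_tval = map_tval_isomorphism[OF iso]
    and upd_comp = fun_upd_comp[unfolded comp_def, symmetric]
  show ?thesis
    using assms(3-)
  proof (induction \<phi> arbitrary: s e)
    case (Eq t u)
    then have "tval A s t \<in> univ A" "tval A s u \<in> univ A"
      by (auto simp: image_Un intro: tval_in_univ[OF closed])
    then show ?case using Eq.prems bij_betw_imp_inj_on[OF bij]
      by (simp add: tval_isomorphism[OF iso] inj_on_eq_iff)
  next
    case (Rel R ts)
    then show ?case
      using map_tval_in_tuples[OF closed, of ts s] iso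
      by (simp add: map_tval isomorphism_def del: map_map)
  next
    case (RVar X ts)
    have "e X \<subseteq> tuples (univ A) (snd X)" using RVar.prems(3) ..
    moreover have "map (tval A s) ts \<in> tuples (univ A) (snd X)"
      using RVar.prems map_tval_in_tuples[OF closed, of ts s] by simp
    ultimately show ?case using RVar.prems(1)
      by (simp add: map_tval map_in_image_map_iff[OF bij] del: map_map)
  next
    case (Ex x \<phi>)
    have "sat B ((\<lambda>x. f (s x))(x := f a)) (\<lambda>X. map f ` e X) \<phi> = sat A (s(x := a)) e \<phi>"
      if "a \<in> univ A" for a
      unfolding upd_comp by (rule Ex.IH) (use Ex.prems that in auto)
    then show ?case by (simp add: univ)
  next
    case (All x \<phi>)
    have "sat B ((\<lambda>x. f (s x))(x := f a)) (\<lambda>X. map f ` e X) \<phi> = sat A (s(x := a)) e \<phi>"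
      if "a \<in> univ A" for a
      unfolding upd_comp by (rule All.IH) (use All.prems that in auto)
    then show ?case by (simp add: univ)
  next
    case (Ex2 X \<phi>)
    have "sat B (\<lambda>x. f (s x)) ((\<lambda>Y. map f ` e Y)(X := map f ` V)) \<phi> = sat A s (e(X := V)) \<phi>"
      if "V \<subseteq> tuples (univ A) (snd X)" for V
      unfolding upd_comp by (rule Ex2.IH) (use Ex2.prems that in auto)
    then show ?case by (auto simp: tuples subset_image_iff)
  next
    case (All2 X \<phi>)
    have "sat B (\<lambda>x. f (s x)) ((\<lambda>Y. map f ` e Y)(X := map f ` V)) \<phi> = sat A s (e(X := V)) \<phi>"
      if "V \<subseteq> tuples (univ A) (snd X)" for V
      unfolding upd_comp by (rule All2.IH) (use All2.prems that in auto)
    then show ?case by (auto simp: tuples all_subset_image)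
  qed (auto simp: image_Un)
qed

lemma models_isomorphism:
  assumes "isomorphism \<tau> f A B" "cst_closed \<tau> A" "sentence L \<tau> \<phi>"
  shows "models A \<phi> = models B \<phi>"
proof -
  note \<phi> = param_formD[OF assms(3)]
  have "models A \<phi> = sat B (\<lambda>x. f ([] ! x)) (\<lambda>X. map f ` {}) \<phi>"
    unfolding holds_def by (rule sat_isomorphism[OF assms(1,2), symmetric]) (use \<phi> in auto)
  also have "\<dots> = models B \<phi>" unfolding holds_def by (rule sat_cong) (use \<phi> in auto)
  finally show ?thesis .
qed


section \<open>The backward translation\<close>

lemma transductionD:
  assumes "transduction L \<tau> \<sigma> \<Phi>"
  shows "param_form L \<tau> 1 (t_univ \<Phi>)"
    and "R \<in> rels \<sigma> \<Longrightarrow> param_form L \<tau> (arity R) (t_rel \<Phi> R)"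
    and "c \<in> csts \<sigma> \<Longrightarrow> t_cst \<Phi> c \<in> csts \<tau>"
  using assms by (auto simp: transduction_def)

lemma univ_star: "univ (star \<Phi> C) = {a \<in> univ C. holds C (t_univ \<Phi>) [a]}"
  by (simp add: star_def Let_def)

lemma rel_star:
  "rel (star \<Phi> C) R = {as \<in> tuples (univ (star \<Phi> C)) (arity R). holds C (t_rel \<Phi> R) as}"
  by (simp add: star_def Let_def)

lemma cst_star: "cst (star \<Phi> C) c = cst C (t_cst \<Phi> c)"
  by (simp add: star_def Let_def)

lemma tval_star: "tval (star \<Phi> C) s = (\<lambda>t. tval C s (rename_tm (t_cst \<Phi>) t))"
proof
  show "tval (star \<Phi> C) s t = tval C s (rename_tm (t_cst \<Phi>) t)" for t
    by (cases t) (simp_all add: cst_star)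
qed

lemma agree_star:
  assumes "agree \<tau> C D" "transduction L \<tau> \<sigma> \<Phi>"
  shows "agree \<sigma> (star \<Phi> C) (star \<Phi> D)"
proof -
  note holds = holds_agree[OF assms(1)] and \<Phi> = transductionD[OF assms(2)]
  have univ: "univ (star \<Phi> C) = univ (star \<Phi> D)"
    using assms(1) holds[OF \<Phi>(1)] by (simp add: univ_star agree_def)
  moreover have "rel (star \<Phi> C) R = rel (star \<Phi> D) R" if "R \<in> rels \<sigma>" for R
    by (simp add: rel_star univ holds[OF \<Phi>(2)[OF that]])
  ultimately show ?thesis
    using assms(1) \<Phi>(3) by (simp add: agree_def cst_star)
qed

lemma fv_sharp_frv_sharp:
  assumes "transduction L \<tau> \<sigma> \<Phi>" "over \<sigma> \<theta>"
  shows "fv (sharp \<Phi> \<theta>) \<subseteq> fv \<theta> \<and> frv (sharp \<Phi> \<theta>) \<subseteq> frv \<theta>"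
proof -
  note \<Phi> = transductionD(1,2)[OF assms(1), THEN param_formD(2)]
    transductionD(1,2)[OF assms(1), THEN param_formD(3)]
  have univ: "fv (inst (t_univ \<Phi>) [Var x]) \<subseteq> {x}" "frv (inst (t_univ \<Phi>) [Var x]) = {}" for x
    using fv_inst[of "t_univ \<Phi>" "[Var x]"] \<Phi> by (auto simp: frv_inst)
  show ?thesis
    using assms(2)
  proof (induction \<theta>)
    case (Rel R ts)
    then show ?case
      using fv_inst[of "t_rel \<Phi> R" "map (rename_tm (t_cst \<Phi>)) ts"] \<Phi>
      by (simp add: frv_inst tm_vars_rename_tm)
  qed (use univ in \<open>auto simp: tm_vars_rename_tm\<close>)
qed

lemma ex_subset_Int: "T \<subseteq> U \<Longrightarrow> (\<exists>V\<subseteq>U. p (V \<inter> T)) \<longleftrightarrow> (\<exists>V\<subseteq>T. p V)"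
  by (metis inf.absorb1 inf_le2 subset_trans)

lemma all_subset_Int: "T \<subseteq> U \<Longrightarrow> (\<forall>V\<subseteq>U. p (V \<inter> T)) \<longleftrightarrow> (\<forall>V\<subseteq>T. p V)"
  using ex_subset_Int[of T U "\<lambda>V. \<not> p V"] by blast

lemma sat_inst_t_univ:
  assumes "transduction L \<tau> \<sigma> \<Phi>"
  shows "sat C (s(x := a)) e (inst (t_univ \<Phi>) [Var x]) = holds C (t_univ \<Phi>) [a]"
  using param_formD[OF transductionD(1)[OF assms]] by (simp add: sat_inst)

lemma tuples_univ_star_subset: "tuples (univ (star \<Phi> C)) k \<subseteq> tuples (univ C) k"
  by (auto simp: tuples_def univ_star)

lemma sat_sharp:
  assumes \<Phi>: "transduction L \<tau> \<sigma> \<Phi>" and closed: "cst_closed \<sigma> (star \<Phi> C)" and "over \<sigma> \<theta>"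
    and "s ` fv \<theta> \<subseteq> univ (star \<Phi> C)"
  shows "sat C s e (sharp \<Phi> \<theta>) = sat (star \<Phi> C) s (\<lambda>X. e X \<inter> tuples (univ (star \<Phi> C)) (snd X)) \<theta>"
proof -
  let ?M = "star \<Phi> C"
  let ?T = "tuples (univ ?M)" and ?r = "\<lambda>e X. e X \<inter> tuples (univ ?M) (snd X)"
  note univ = univ_star sat_inst_t_univ[OF \<Phi>]
  have rvar_upd: "?r (e(X := V)) = (?r e)(X := V \<inter> ?T (snd X))" for e :: "rvar \<Rightarrow> _" and X V
    by (auto simp: fun_eq_iff)
  show ?thesis
    using assms(3-)
  proof (induction \<theta> arbitrary: s e)
    case (Eq t u)
    then show ?case by (simp add: tval_star)
  next
    case (Rel R ts)
    have "sat C s e (sharp \<Phi> (Rel R ts)) = holds C (t_rel \<Phi> R) (map (tval ?M s) ts)"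
      using param_formD[OF transductionD(2)[OF \<Phi>]] Rel.prems
      by (simp add: sat_inst tval_star comp_def)
    then show ?case
      using map_tval_in_tuples[OF closed, of ts s] Rel.prems by (simp add: rel_star)
  next
    case (RVar X ts)
    then show ?case
      using map_tval_in_tuples[OF closed, of ts s] by (simp add: tval_star comp_def)
  next
    case (Ex x \<theta>)
    have "sat C (s(x := a)) e (sharp \<Phi> \<theta>) = sat ?M (s(x := a)) (?r e) \<theta>" if "a \<in> univ ?M" for a
      by (rule Ex.IH) (use Ex.prems that in auto)
    then show ?case by (auto simp: univ)
  next
    case (All x \<theta>)
    have "sat C (s(x := a)) e (sharp \<Phi> \<theta>) = sat ?M (s(x := a)) (?r e) \<theta>" if "a \<in> univ ?M" for a
      by (rule All.IH) (use All.prems that in auto)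
    then show ?case by (auto simp: univ)
  next
    case (Ex2 X \<theta>)
    have "sat C s (e(X := V)) (sharp \<Phi> \<theta>) = sat ?M s ((?r e)(X := V \<inter> ?T (snd X))) \<theta>" for V
      unfolding rvar_upd[symmetric] by (rule Ex2.IH) (use Ex2.prems in auto)
    then show ?case
      using ex_subset_Int[OF tuples_univ_star_subset[of \<Phi> C "snd X"],
          of "\<lambda>V. sat ?M s ((?r e)(X := V)) \<theta>"] by simp
  next
    case (All2 X \<theta>)
    have "sat C s (e(X := V)) (sharp \<Phi> \<theta>) = sat ?M s ((?r e)(X := V \<inter> ?T (snd X))) \<theta>" for V
      unfolding rvar_upd[symmetric] by (rule All2.IH) (use All2.prems in auto)
    then show ?case
      using all_subset_Int[OF tuples_univ_star_subset[of \<Phi> C "snd X"],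
          of "\<lambda>V. sat ?M s ((?r e)(X := V)) \<theta>"] by simp
  qed (auto simp: image_Un)
qed

lemma models_sharp:
  assumes "transduction L \<tau> \<sigma> \<Phi>" "cst_closed \<sigma> (star \<Phi> C)" "sentence L \<sigma> \<theta>"
  shows "models C (sharp \<Phi> \<theta>) = models (star \<Phi> C) \<theta>"
  using sat_sharp[OF assms(1,2), of \<theta> "(!) []" "\<lambda>_. {}"] param_formD[OF assms(3)]
  by (simp add: holds_def)

lemma (in tame_fragment) sentence_sharp:
  assumes "vocabulary \<tau>" "vocabulary \<sigma>" "transduction L \<tau> \<sigma> \<Phi>" "sentence L \<sigma> \<theta>"
  shows "sentence L \<tau> (sharp \<Phi> \<theta>)"
  using sharp_closed[OF assms(1-3), of \<theta>] fv_sharp_frv_sharp[OF assms(3), of \<theta>] assms(4)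
  by (auto simp: param_form_def Lang_def)


section \<open>Expansions by one symbol\<close>

abbreviation add_cst :: "vocab \<Rightarrow> csym \<Rightarrow> vocab" where
  "add_cst \<tau> c \<equiv> add_csts \<tau> [c]"

abbreviation add_rel :: "vocab \<Rightarrow> rsym \<Rightarrow> vocab" where
  "add_rel \<tau> R \<equiv> add_rels \<tau> [R]"

abbreviation set_cst :: "struct \<Rightarrow> csym \<Rightarrow> nat \<Rightarrow> struct" where
  "set_cst A c a \<equiv> set_csts A [c] [a]"

abbreviation set_rel :: "struct \<Rightarrow> rsym \<Rightarrow> nat list set \<Rightarrow> struct" where
  "set_rel A R V \<equiv> set_rels A [R] [V]"

lemma add_csts_simps [simp]:
  "rels (add_csts \<tau> cs) = rels \<tau>" "csts (add_csts \<tau> cs) = csts \<tau> \<union> set cs" "add_csts \<tau> [] = \<tau>"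
  "add_csts (add_cst \<tau> c) cs = add_csts \<tau> (c # cs)"
  by (auto simp: add_csts_def)

lemma add_rels_simps [simp]:
  "csts (add_rels \<tau> Rs) = csts \<tau>" "rels (add_rels \<tau> Rs) = rels \<tau> \<union> set Rs" "add_rels \<tau> [] = \<tau>"
  "add_rels (add_rel \<tau> R) Rs = add_rels \<tau> (R # Rs)"
  by (auto simp: add_rels_def)

lemma set_csts_simps [simp]:
  "univ (set_csts M cs as) = univ M" "rel (set_csts M cs as) = rel M"
  "cst (set_cst M c a) = (cst M)(c := a)" "set_csts M [] as = M"
  by (auto simp: set_csts_def fun_eq_iff)

lemma set_rels_simps [simp]:
  "univ (set_rels M Rs Vs) = univ M" "cst (set_rels M Rs Vs) = cst M"
  "rel (set_rel M R V) = (rel M)(R := V)" "set_rels M [] Vs = M"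
  by (auto simp: set_rels_def fun_eq_iff)

lemma map_of_zip_notin: "c \<notin> set cs \<Longrightarrow> map_of (zip cs as) c = None"
  by (auto simp: map_of_eq_None_iff dest: set_zip_leftD)

lemma set_csts_Cons: "c \<notin> set cs \<Longrightarrow> set_csts M (c # cs) (a # as) = set_csts (set_cst M c a) cs as"
  unfolding set_csts_def
  by (rule struct.equality) (auto simp: map_of_zip_notin fun_eq_iff split: option.splits)

lemma set_rels_Cons: "R \<notin> set Rs \<Longrightarrow> set_rels M (R # Rs) (V # Vs) = set_rels (set_rel M R V) Rs Vs"
  unfolding set_rels_def
  by (rule struct.equality) (auto simp: map_of_zip_notin fun_eq_iff split: option.splits)

lemma vocabulary_add_csts: "vocabulary \<tau> \<Longrightarrow> vocabulary (add_csts \<tau> cs)"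
  by (simp add: vocabulary_def)

lemma vocabulary_add_rels: "vocabulary \<tau> \<Longrightarrow> vocabulary (add_rels \<tau> Rs)"
  by (simp add: vocabulary_def)

lemma set_cst_in_Str: "A \<in> Str \<tau> \<Longrightarrow> a \<in> univ A \<Longrightarrow> set_cst A c a \<in> Str (add_cst \<tau> c)"
  by (auto simp: Str_def)

lemma set_rel_in_Str:
  "A \<in> Str \<tau> \<Longrightarrow> V \<subseteq> tuples (univ A) (arity R) \<Longrightarrow> set_rel A R V \<in> Str (add_rel \<tau> R)"
  by (auto simp: Str_def)

lemma cst_closed_set_cst:
  "c \<notin> csts \<tau> \<Longrightarrow> cst_closed (add_cst \<tau> c) (set_cst A c a) \<longleftrightarrow> cst_closed \<tau> A \<and> a \<in> univ A"
  by (auto simp: cst_closed_def)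

lemma cst_closed_set_rel: "cst_closed (add_rel \<tau> R) (set_rel A R V) = cst_closed \<tau> A"
  by (auto simp: cst_closed_def)

lemma isomorphism_set_cst:
  "isomorphism \<tau> f A B \<Longrightarrow> isomorphism (add_cst \<tau> c) f (set_cst A c a) (set_cst B c (f a))"
  by (auto simp: isomorphism_def)

lemma isomorphism_set_rel:
  assumes "isomorphism \<tau> f A B" "V \<subseteq> tuples (univ A) (arity R)"
  shows "isomorphism (add_rel \<tau> R) f (set_rel A R V) (set_rel B R (map f ` V))"
  using assms map_in_image_map_iff[OF isomorphism_bij[OF assms(1)] assms(2)]
  by (auto simp: isomorphism_def)


section \<open>Values of definable polynomials\<close>

lemma finite_tuples: "finite U \<Longrightarrow> finite (tuples U k)"
  using finite_lists_length_eq[of U k] by (simp add: tuples_def conj_commute)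

lemma tuples_0 [simp]: "tuples U 0 = {[]}"
  by (auto simp: tuples_def)

lemma tuples_Suc: "tuples U (Suc k) = (\<lambda>(a, as). a # as) ` (U \<times> tuples U k)"
  by (auto simp: tuples_def length_Suc_conv image_iff)

lemma rel_tuples_Nil [simp]: "rel_tuples U [] = {[]}"
  by (auto simp: rel_tuples_def)

lemma rel_tuples_Cons:
  "rel_tuples U (R # Rs) = (\<lambda>(V, Vs). V # Vs) ` (Pow (tuples U (arity R)) \<times> rel_tuples U Rs)"
  by (auto simp: rel_tuples_def list_all2_Cons1 image_iff)

lemma finite_rel_tuples: "finite U \<Longrightarrow> finite (rel_tuples U Rs)"
  by (induction Rs) (auto simp: rel_tuples_Cons finite_tuples)

lemma sum_filter_Cons:
  assumes "finite X" "finite Y"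
  shows "(\<Sum>z\<in>{z\<in>(\<lambda>(x, y). x # y) ` (X \<times> Y). p z}. g z) = (\<Sum>x\<in>X. \<Sum>y\<in>{y\<in>Y. p (x # y)}. g (x # y))"
proof -
  have "inj_on (\<lambda>(x, y). x # y) (X \<times> Y)" by (auto intro: inj_onI)
  then show ?thesis
    using assms by (simp add: sum.inter_filter sum.reindex sum.cartesian_product split_def comp_def)
qed

lemma lpoly_val_SumC_Nil: "lpoly_val M (SumC [] \<phi> p) = (if models M \<phi> then lpoly_val M p else 0)"
  by simp

lemma lpoly_val_SumR_Nil: "lpoly_val M (SumR [] \<phi> p) = (if models M \<phi> then lpoly_val M p else 0)"
  by simp

lemma lpoly_val_SumC_Cons:
  assumes "finite (univ M)" "c \<notin> set cs"
  shows "lpoly_val M (SumC (c # cs) \<phi> p) = (\<Sum>a\<in>univ M. lpoly_val (set_cst M c a) (SumC cs \<phi> p))"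
  using assms(1) by (simp add: tuples_Suc sum_filter_Cons finite_tuples set_csts_Cons[OF assms(2)])

lemma lpoly_val_SumR_Cons:
  assumes "finite (univ M)" "R \<notin> set Rs"
  shows "lpoly_val M (SumR (R # Rs) \<phi> p) =
    (\<Sum>V\<in>Pow (tuples (univ M) (arity R)). lpoly_val (set_rel M R V) (SumR Rs \<phi> p))"
  using assms(1)
  by (simp add: rel_tuples_Cons sum_filter_Cons finite_rel_tuples finite_tuples
      set_rels_Cons[OF assms(2)])

lemma is_lpoly_SumC_Cons:
  "is_lpoly L \<tau> (SumC (c # cs) \<phi> p) \<Longrightarrow>
    c \<notin> csts \<tau> \<and> c \<notin> set cs \<and> is_lpoly L (add_cst \<tau> c) (SumC cs \<phi> p)"
  by auto

lemma is_lpoly_SumR_Cons: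
  "is_lpoly L \<tau> (SumR (R # Rs) \<phi> p) \<Longrightarrow>
    R \<notin> rels \<tau> \<and> R \<notin> set Rs \<and> arity R \<le> 1 \<and> is_lpoly L (add_rel \<tau> R) (SumR Rs \<phi> p)"
  by auto

lemma lpoly_symbol_induct [case_names Mono SumC_Nil SumC_Cons SumR_Nil SumR_Cons]:
  assumes "\<And>m. Q (Mono m)"
    and "\<And>\<phi> p. Q p \<Longrightarrow> Q (SumC [] \<phi> p)" and "\<And>c cs \<phi> p. Q (SumC cs \<phi> p) \<Longrightarrow> Q (SumC (c # cs) \<phi> p)"
    and "\<And>\<phi> p. Q p \<Longrightarrow> Q (SumR [] \<phi> p)" and "\<And>R Rs \<phi> p. Q (SumR Rs \<phi> p) \<Longrightarrow> Q (SumR (R # Rs) \<phi> p)"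
  shows "Q P"
proof (induction P)
  case (SumC cs \<phi> p)
  then show ?case by (induction cs) (auto intro: assms)
next
  case (SumR Rs \<phi> p)
  then show ?case by (induction Rs) (auto intro: assms)
qed (rule assms)

declare lpoly_val.simps(2,3) [simp del] is_lpoly.simps(2,3) [simp del]

lemma mono_val_isomorphism:
  assumes "isomorphism \<tau> f A B" "cst_closed \<tau> A" "is_mono L \<tau> m"
  shows "mono_val A m = mono_val B m"
  using assms(3)
proof (induction m)
  case (ProdC c \<phi> t)
  note bij = isomorphism_bij[OF assms(1)]
  have models: "models (set_cst A c a) \<phi> = models (set_cst B c (f a)) \<phi>" if "a \<in> univ A" for a
    using ProdC that assms(2)
    by (intro models_isomorphism[OF isomorphism_set_cst[OF assms(1)]])
      (auto simp: cst_closed_set_cst)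
  have "bij_betw f {a \<in> univ A. models (set_cst A c a) \<phi>} {b \<in> univ B. models (set_cst B c b) \<phi>}"
    using bij by (rule bij_betw_subset) (use models bij_betw_imp_surj_on[OF bij] in force)+
  from bij_betw_same_card[OF this] show ?case by (simp add: prod_constant)
qed auto

lemma lpoly_val_SumC_Cons_cong:
  assumes "bij_betw f (univ A) (univ B)" "finite (univ A)" "c \<notin> set cs"
    and "\<And>a. a \<in> univ A \<Longrightarrow>
      lpoly_val (set_cst A c a) (SumC cs \<phi> p) = lpoly_val (set_cst B c (f a)) (SumC cs \<phi> p)"
  shows "lpoly_val A (SumC (c # cs) \<phi> p) = lpoly_val B (SumC (c # cs) \<phi> p)"
proof -
  have "lpoly_val A (SumC (c # cs) \<phi> p) =
      (\<Sum>a\<in>univ A. lpoly_val (set_cst B c (f a)) (SumC cs \<phi> p))"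
    using assms by (simp add: lpoly_val_SumC_Cons)
  also have "\<dots> = (\<Sum>b\<in>univ B. lpoly_val (set_cst B c b) (SumC cs \<phi> p))"
    by (rule sum.reindex_bij_betw[OF assms(1)])
  also have "\<dots> = lpoly_val B (SumC (c # cs) \<phi> p)"
    using assms bij_betw_finite[OF assms(1)] by (simp add: lpoly_val_SumC_Cons)
  finally show ?thesis .
qed

lemma lpoly_val_SumR_Cons_cong:
  assumes "bij_betw f (univ A) (univ B)" "finite (univ A)" "R \<notin> set Rs"
    and "\<And>V. V \<in> Pow (tuples (univ A) (arity R)) \<Longrightarrow>
      lpoly_val (set_rel A R V) (SumR Rs \<phi> p) = lpoly_val (set_rel B R (map f ` V)) (SumR Rs \<phi> p)"
  shows "lpoly_val A (SumR (R # Rs) \<phi> p) = lpoly_val B (SumR (R # Rs) \<phi> p)"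
proof -
  let ?T = "\<lambda>M. Pow (tuples (univ M) (arity R))"
  have "lpoly_val A (SumR (R # Rs) \<phi> p) =
      (\<Sum>V\<in>?T A. lpoly_val (set_rel B R (map f ` V)) (SumR Rs \<phi> p))"
    using assms by (simp add: lpoly_val_SumR_Cons)
  also have "\<dots> = (\<Sum>W\<in>?T B. lpoly_val (set_rel B R W) (SumR Rs \<phi> p))"
    by (rule sum.reindex_bij_betw[OF bij_betw_Pow[OF bij_betw_tuples[OF assms(1)]]])
  also have "\<dots> = lpoly_val B (SumR (R # Rs) \<phi> p)"
    using assms bij_betw_finite[OF assms(1)] by (simp add: lpoly_val_SumR_Cons)
  finally show ?thesis .
qed

lemma lpoly_val_isomorphism:
  assumes "isomorphism \<tau> f A B" "cst_closed \<tau> A" "finite (univ A)" "is_lpoly L \<tau> P"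
  shows "lpoly_val A P = lpoly_val B P"
  using assms
proof (induction P arbitrary: \<tau> A B rule: lpoly_symbol_induct)
  case (Mono m)
  then show ?case by (auto intro: mono_val_isomorphism)
next
  case (SumC_Nil \<phi> p)
  then have "sentence L \<tau> \<phi>" "is_lpoly L \<tau> p" by (simp_all add: is_lpoly.simps)
  then show ?case
    using SumC_Nil.IH[OF SumC_Nil.prems(1-3)] models_isomorphism[OF SumC_Nil.prems(1,2)]
    by (simp add: lpoly_val_SumC_Nil)
next
  case (SumR_Nil \<phi> p)
  then have "sentence L \<tau> \<phi>" "is_lpoly L \<tau> p" by (simp_all add: is_lpoly.simps)
  then show ?case
    using SumR_Nil.IH[OF SumR_Nil.prems(1-3)] models_isomorphism[OF SumR_Nil.prems(1,2)]
    by (simp add: lpoly_val_SumR_Nil)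
next
  case (SumC_Cons c cs \<phi> p)
  note c_new = is_lpoly_SumC_Cons[OF SumC_Cons.prems(4)]
  show ?case
  proof (rule lpoly_val_SumC_Cons_cong[OF isomorphism_bij[OF SumC_Cons.prems(1)]])
    show "lpoly_val (set_cst A c a) (SumC cs \<phi> p) = lpoly_val (set_cst B c (f a)) (SumC cs \<phi> p)"
      if "a \<in> univ A" for a
      using c_new SumC_Cons.prems that
      by (intro SumC_Cons.IH[of "add_cst \<tau> c"] isomorphism_set_cst) (auto simp: cst_closed_set_cst)
  qed (use c_new SumC_Cons.prems in auto)
next
  case (SumR_Cons R Rs \<phi> p)
  note R_new = is_lpoly_SumR_Cons[OF SumR_Cons.prems(4)]
  show ?case
  proof (rule lpoly_val_SumR_Cons_cong[OF isomorphism_bij[OF SumR_Cons.prems(1)]])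
    show "lpoly_val (set_rel A R V) (SumR Rs \<phi> p) =
        lpoly_val (set_rel B R (map f ` V)) (SumR Rs \<phi> p)"
      if "V \<in> Pow (tuples (univ A) (arity R))" for V
      using R_new SumR_Cons.prems that
      by (intro SumR_Cons.IH[of "add_rel \<tau> R"] isomorphism_set_rel) (auto simp: cst_closed_set_rel)
  qed (use R_new SumR_Cons.prems in auto)
qed

lemma models_agree: "agree \<tau> A B \<Longrightarrow> sentence L \<tau> \<phi> \<Longrightarrow> models A \<phi> = models B \<phi>"
  by (rule holds_agree)

lemma lpoly_val_agree:
  "agree \<tau> A B \<Longrightarrow> cst_closed \<tau> A \<Longrightarrow> finite (univ A) \<Longrightarrow> is_lpoly L \<tau> P \<Longrightarrow> lpoly_val A P = lpoly_val B P"
  by (rule lpoly_val_isomorphism[OF isomorphism_id])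


section \<open>Separable functions and matrices of finite rank\<close>

inductive separable :: "'i set \<Rightarrow> 'j set \<Rightarrow> ('i \<Rightarrow> 'j \<Rightarrow> 'a::comm_semiring_1) \<Rightarrow> bool" for I J where
  product: "(\<And>i j. i \<in> I \<Longrightarrow> j \<in> J \<Longrightarrow> h i j = f i * g j) \<Longrightarrow> separable I J h"
| plus: "separable I J h1 \<Longrightarrow> separable I J h2 \<Longrightarrow>
    (\<And>i j. i \<in> I \<Longrightarrow> j \<in> J \<Longrightarrow> h i j = h1 i j + h2 i j) \<Longrightarrow> separable I J h"

lemma separable_cong:
  assumes "separable I J h" "\<And>i j. i \<in> I \<Longrightarrow> j \<in> J \<Longrightarrow> h' i j = h i j"
  shows "separable I J h'"
  using assms
proof (induction arbitrary: h' rule: separable.induct)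
  case (product h f g)
  then show ?case by (intro separable.product[of I J h' f g]) simp
next
  case (plus h1 h2 h)
  show ?case by (rule separable.plus[OF plus.hyps(1,2)]) (simp add: plus)
qed

lemma separable_transpose: "separable I J h \<Longrightarrow> separable J I (\<lambda>j i. h i j)"
proof (induction rule: separable.induct)
  case (product h f g)
  then show ?case by (intro separable.product[of J I _ g f]) (simp add: mult.commute)
next
  case (plus h1 h2 h)
  show ?case by (rule separable.plus[OF plus.IH]) (simp add: plus.hyps)
qed

lemma separable_0: "separable I J (\<lambda>i j. 0)"
  by (rule separable.product[of _ _ _ "\<lambda>_. 0" "\<lambda>_. 0"]) simp

lemma separable_add: "separable I J h1 \<Longrightarrow> separable I J h2 \<Longrightarrow> separable I J (\<lambda>i j. h1 i j + h2 i j)"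
  by (erule (1) separable.plus) simp

lemma separable_mult:
  assumes "separable I J h1" "separable I J h2"
  shows "separable I J (\<lambda>i j. h1 i j * h2 i j)"
  using assms(1)
proof (induction rule: separable.induct)
  case h1: (product h1 f1 g1)
  show ?case
    using assms(2)
  proof (induction rule: separable.induct)
    case (product h2 f2 g2)
    show ?case
      by (rule separable.product[of _ _ _ "\<lambda>i. f1 i * f2 i" "\<lambda>j. g1 j * g2 j"])
        (simp add: h1 product mult_ac)
  next
    case (plus k1 k2 h2)
    show ?case by (rule separable.plus[OF plus.IH]) (simp add: plus.hyps distrib_left)
  qed
next
  case (plus k1 k2 h1)
  show ?case by (rule separable.plus[OF plus.IH]) (simp add: plus.hyps distrib_right)
qed

lemma separable_sum: "(\<And>k. k \<in> K \<Longrightarrow> separable I J (h k)) \<Longrightarrow> separable I J (\<lambda>i j. \<Sum>k\<in>K. h k i j)"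
  by (induction K rule: infinite_finite_induct) (auto intro: separable_0 separable_add)

lemma separable_hom:
  assumes "separable I J h" "\<And>x y. \<phi> (x + y) = \<phi> x + \<phi> y" "\<And>x y. \<phi> (x * y) = \<phi> x * \<phi> y"
  shows "separable I J (\<lambda>i j. \<phi> (h i j))"
  using assms(1)
proof (induction rule: separable.induct)
  case (product h f g)
  then show ?case
    by (intro separable.product[of _ _ _ "\<lambda>i. \<phi> (f i)" "\<lambda>j. \<phi> (g j)"]) (simp add: assms)
next
  case (plus h1 h2 h)
  show ?case by (rule separable.plus[OF plus.IH]) (simp add: plus.hyps assms)
qed

lemma separable_finite_range_left:
  assumes "finite (\<alpha> ` I)"
  shows "separable I J (\<lambda>i j. k (\<alpha> i) j)"
proof (rule separable_cong)
  show "separable I J (\<lambda>i j. \<Sum>z\<in>\<alpha> ` I. of_bool (\<alpha> i = z) * k z j)"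
    by (rule separable_sum, rule separable.product) (rule refl)
  show "k (\<alpha> i) j = (\<Sum>z\<in>\<alpha> ` I. of_bool (\<alpha> i = z) * k z j)" if "i \<in> I" for i j
    using assms that by (simp add: of_bool_def if_distrib[of "\<lambda>x. x * _"] cong: if_cong)
qed

lemma separable_finite_range_right: "finite (\<beta> ` J) \<Longrightarrow> separable I J (\<lambda>i j. k i (\<beta> j))"
  using separable_transpose[OF separable_finite_range_left[of \<beta> J I "\<lambda>z i. k i z"]] .

lemma separable_double_sum:
  assumes "separable I' J' h"
    and "\<And>i x. i \<in> I \<Longrightarrow> x \<in> X i \<Longrightarrow> \<alpha> i x \<in> I'" and "\<And>j y. j \<in> J \<Longrightarrow> y \<in> Y j \<Longrightarrow> \<beta> j y \<in> J'"
  shows "separable I J (\<lambda>i j. \<Sum>x\<in>X i. \<Sum>y\<in>Y j. h (\<alpha> i x) (\<beta> j y))"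
  using assms(1)
proof (induction rule: separable.induct)
  case (product h f g)
  show ?case
    by (rule separable.product[of _ _ _ "\<lambda>i. \<Sum>x\<in>X i. f (\<alpha> i x)" "\<lambda>j. \<Sum>y\<in>Y j. g (\<beta> j y)"])
      (simp add: product assms sum_product)
next
  case (plus h1 h2 h)
  show ?case by (rule separable.plus[OF plus.IH]) (simp add: plus.hyps assms sum.distrib)
qed

lemma vector_space_pointwise: "vector_space (\<lambda>(c::'k::field) v (j::'j). c * v j)"
  by unfold_locales (auto simp: fun_eq_iff algebra_simps)

lemma separable_rows_in_finite_span:
  fixes h :: "'i \<Rightarrow> 'j \<Rightarrow> 'k::field"
  assumes "separable I J h"
  shows "\<exists>T. finite T \<and> matrix_row J h ` I \<subseteq> module.span (\<lambda>c v j. c * v j) T"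
proof -
  interpret vector_space "\<lambda>(c::'k) v (j::'j). c * v j" by (rule vector_space_pointwise)
  show ?thesis
    using assms
  proof (induction rule: separable.induct)
    case (product h f g)
    let ?g = "\<lambda>j. if j \<in> J then g j else 0"
    have "matrix_row J h i = (\<lambda>j. f i * ?g j)" if "i \<in> I" for i
      using product that by (auto simp: matrix_row_def fun_eq_iff)
    then have "matrix_row J h ` I \<subseteq> span {?g}"
      using span_scale[OF span_base[of ?g "{?g}"]] by auto
    then show ?case by blast
  next
    case (plus h1 h2 h)
    then obtain T1 T2 where T: "finite T1" "finite T2"
      "matrix_row J h1 ` I \<subseteq> span T1" "matrix_row J h2 ` I \<subseteq> span T2" by auto
    have "matrix_row J h i \<in> span (T1 \<union> T2)" if "i \<in> I" for i
    proof -
      have "matrix_row J h i = matrix_row J h1 i + matrix_row J h2 i"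
        using plus.hyps(3) that by (auto simp: matrix_row_def fun_eq_iff)
      moreover have "matrix_row J h1 i \<in> span (T1 \<union> T2)" "matrix_row J h2 i \<in> span (T1 \<union> T2)"
        using T(3,4) that span_mono[of T1 "T1 \<union> T2"] span_mono[of T2 "T1 \<union> T2"] by blast+
      ultimately show ?thesis by (simp add: span_add)
    qed
    then show ?case using T(1,2) by (intro exI[of _ "T1 \<union> T2"]) auto
  qed
qed

lemma matrix_rank_separable:
  fixes h :: "'i \<Rightarrow> 'j \<Rightarrow> 'k::field"
  assumes "separable I J h"
  shows "matrix_rank I J h < \<infinity>"
proof -
  interpret vector_space "\<lambda>(c::'k) v (j::'j). c * v j" by (rule vector_space_pointwise)
  obtain T where T: "finite T" "matrix_row J h ` I \<subseteq> span T"
    using separable_rows_in_finite_span[OF assms] by auto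
  have "matrix_rank I J h \<le> enat (card T)"
    unfolding matrix_rank_def lin_dependent_def
  proof (rule SUP_least)
    fix S assume "S \<in> {S. S \<subseteq> matrix_row J h ` I \<and> finite S \<and> independent S}"
    then have "independent S" "S \<subseteq> span T" using T(2) by auto
    then show "enat (card S) \<le> enat (card T)" using independent_span_bound[OF T(1)] by simp
  qed
  also have "\<dots> < \<infinity>" by simp
  finally show ?thesis .
qed


section \<open>Sums over disjoint images\<close>

lemma (in comm_monoid_set) split_images:
  assumes "finite X" "finite Y" "inj_on i X" "inj_on j Y" "i ` X \<inter> j ` Y = {}" "T \<subseteq> i ` X \<union> j ` Y"
  shows "F g T =
    f (F (\<lambda>x. if i x \<in> T then g (i x) else \<^bold>1) X) (F (\<lambda>y. if j y \<in> T then g (j y) else \<^bold>1) Y)"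
proof -
  have "F g T = F (\<lambda>a. if a \<in> T then g a else \<^bold>1) (i ` X \<union> j ` Y)"
    using assms by (intro mono_neutral_cong_left) auto
  also have "\<dots> =
      f (F (\<lambda>a. if a \<in> T then g a else \<^bold>1) (i ` X)) (F (\<lambda>a. if a \<in> T then g a else \<^bold>1) (j ` Y))"
    using assms by (intro union_disjoint) auto
  finally show ?thesis using assms by (simp add: reindex comp_def)
qed

lemma bij_betw_Pow_disjoint_images:
  assumes "inj_on i X" "inj_on j Y" "i ` X \<inter> j ` Y = {}"
  shows "bij_betw (\<lambda>(V, W). i ` V \<union> j ` W) (Pow X \<times> Pow Y) (Pow (i ` X \<union> j ` Y))"
proof (rule bij_betw_byWitness[where f' = "\<lambda>Z. ({x\<in>X. i x \<in> Z}, {y\<in>Y. j y \<in> Z})"])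
  have "i x \<noteq> j y" if "x \<in> X" "y \<in> Y" for x y using that assms(3) by blast
  then have "{x\<in>X. i x \<in> i ` V \<union> j ` W} = V" "{y\<in>Y. j y \<in> i ` V \<union> j ` W} = W"
    if "V \<subseteq> X" "W \<subseteq> Y" for V W
    using that assms(1,2) by (fastforce dest: inj_onD)+
  then show "\<forall>p\<in>Pow X \<times> Pow Y.
      (\<lambda>Z. ({x\<in>X. i x \<in> Z}, {y\<in>Y. j y \<in> Z})) ((\<lambda>(V, W). i ` V \<union> j ` W) p) = p"
    by auto
qed auto

lemma sum_Pow_split_images:
  assumes "finite X" "finite Y" "inj_on i X" "inj_on j Y" "i ` X \<inter> j ` Y = {}" "T \<subseteq> i ` X \<union> j ` Y"
  shows "(\<Sum>Z\<in>Pow T. g Z) = (\<Sum>V\<in>Pow X. \<Sum>W\<in>Pow Y. if i ` V \<union> j ` W \<subseteq> T then g (i ` V \<union> j ` W) else 0)"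
proof -
  have "(\<Sum>Z\<in>Pow T. g Z) = (\<Sum>Z\<in>Pow (i ` X \<union> j ` Y). if Z \<subseteq> T then g Z else 0)"
    using assms by (intro sum.mono_neutral_cong_left) auto
  also have "\<dots> = (\<Sum>(V, W)\<in>Pow X \<times> Pow Y. if i ` V \<union> j ` W \<subseteq> T then g (i ` V \<union> j ` W) else 0)"
    by (subst sum.reindex_bij_betw[OF bij_betw_Pow_disjoint_images[OF assms(3-5)], symmetric])
      (auto intro!: sum.cong)
  finally show ?thesis by (simp add: sum.cartesian_product)
qed


section \<open>Expansions of rich disjoint unions\<close>

lemma rich_vocab_simps [simp]:
  "rels (rich_vocab \<tau>) = RIn ` rels \<tau> \<union> {PLeft, PRight}"
  "csts (rich_vocab \<tau>) = CLeft ` csts \<tau> \<union> CRight ` csts \<tau>"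
  by (auto simp: rich_vocab_def)

lemma rich_union_simps [simp]:
  "univ (rich_union A B) = inl ` univ A \<union> inr ` univ B"
  "rel (rich_union A B) = rich_rel A B" "cst (rich_union A B) = rich_cst A B"
  by (auto simp: rich_union_def)

lemma vocabulary_rich_vocab: "vocabulary \<tau> \<Longrightarrow> vocabulary (rich_vocab \<tau>)"
  by (simp add: vocabulary_def)

lemma cst_closed_rich_union: "A \<in> Str \<tau> \<Longrightarrow> B \<in> Str \<tau> \<Longrightarrow> cst_closed (rich_vocab \<tau>) (rich_union A B)"
  by (auto simp: Str_def cst_closed_def)

lemma finite_univ_star: "A \<in> Str \<tau> \<Longrightarrow> B \<in> Str \<tau> \<Longrightarrow> finite (univ (star \<Phi> (rich_union A B)))"
  by (auto simp: Str_def univ_star)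

lemma inj_inl: "inj_on inl X" and inj_inr: "inj_on inr X"
  by (simp_all add: inj_on_def sum_encode_eq)

lemma inl_neq_inr: "inl a \<noteq> inr b"
  by (simp add: sum_encode_eq)

lemma (in comm_monoid_set) split_univ_star:
  assumes "A \<in> Str \<tau>" "B \<in> Str \<tau>" "M = star \<Phi> (rich_union A B)"
  shows "F g (univ M) = f
    (F (\<lambda>x. if inl x \<in> univ M then g (inl x) else \<^bold>1) (univ A))
    (F (\<lambda>y. if inr y \<in> univ M then g (inr y) else \<^bold>1) (univ B))"
  using assms by (intro split_images inj_inl inj_inr) (auto simp: Str_def univ_star inl_neq_inr)

lemma tuples_1: "tuples U (Suc 0) = (\<lambda>a. [a]) ` U"
  by (auto simp: tuples_Suc)

lemma sum_Pow_tuples_star: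
  assumes "A \<in> Str \<tau>" "B \<in> Str \<tau>" "M = star \<Phi> (rich_union A B)"
  shows "(\<Sum>Z\<in>Pow (tuples (univ M) 1). g Z) =
    (\<Sum>V\<in>Pow (tuples (univ A) 1). \<Sum>W\<in>Pow (tuples (univ B) 1).
      if map inl ` V \<union> map inr ` W \<subseteq> tuples (univ M) 1 then g (map inl ` V \<union> map inr ` W) else 0)"
proof (rule sum_Pow_split_images)
  show "finite (tuples (univ A) 1)" "finite (tuples (univ B) 1)"
    using assms by (auto simp: Str_def finite_tuples)
  show "inj_on (map inl) (tuples (univ A) 1)" "inj_on (map inr) (tuples (univ B) 1)"
    by (auto simp: tuples_1 inj_on_def sum_encode_eq)
  show "map inl ` tuples (univ A) 1 \<inter> map inr ` tuples (univ B) 1 = {}"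
    by (auto simp: tuples_1 inl_neq_inr)
  show "tuples (univ M) 1 \<subseteq> map inl ` tuples (univ A) 1 \<union> map inr ` tuples (univ B) 1"
    by (auto simp: tuples_1 assms univ_star image_image)
qed

definition expand_cst :: "transd \<Rightarrow> csym \<Rightarrow> csym \<Rightarrow> transd" where
  "expand_cst \<Phi> c d = \<Phi>\<lparr>t_cst := (t_cst \<Phi>)(c := d)\<rparr>"

definition rel_form :: "rsym \<Rightarrow> form" where
  "rel_form R = Rel R (map Var [0..<arity R])"

definition expand_rel :: "transd \<Rightarrow> rsym \<Rightarrow> transd" where
  "expand_rel \<Phi> R = \<Phi>\<lparr>t_rel := (t_rel \<Phi>)(R := rel_form (RIn R))\<rparr>"

lemma holds_rel_form: "length as = arity R \<Longrightarrow> holds C (rel_form R) as \<longleftrightarrow> as \<in> rel C R"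
  using map_nth[of as] by (simp add: holds_def rel_form_def comp_def)

lemma transduction_expand_cst:
  assumes "transduction L (rich_vocab \<tau>) \<tau> \<Phi>" "d \<in> {CLeft c, CRight c}"
  shows "transduction L (rich_vocab (add_cst \<tau> c)) (add_cst \<tau> c) (expand_cst \<Phi> c d)"
proof -
  have "param_form L (rich_vocab \<tau>) k \<phi> \<Longrightarrow> param_form L (rich_vocab (add_cst \<tau> c)) k \<phi>" for k \<phi>
    by (erule param_form_mono) auto
  then show ?thesis using assms by (auto simp: transduction_def expand_cst_def)
qed

lemma agree_star_expand_cst:
  assumes "transduction L (rich_vocab \<tau>) \<tau> \<Phi>" "c \<notin> csts \<tau>"
    and C: "C = rich_union (set_cst A c x) (set_cst B c y)"
  shows "agree (add_cst \<tau> c) (star (expand_cst \<Phi> c d) C)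
    (set_cst (star \<Phi> (rich_union A B)) c (cst C d))"
proof -
  have "agree (rich_vocab \<tau>) C (rich_union A B)"
    using assms(2) by (auto simp: agree_def C)
  then have "agree \<tau> (star \<Phi> C) (star \<Phi> (rich_union A B))"
    using assms(1) by (rule agree_star)
  moreover have "univ (star (expand_cst \<Phi> c d) C) = univ (star \<Phi> C)"
    "rel (star (expand_cst \<Phi> c d) C) = rel (star \<Phi> C)"
    "cst (star (expand_cst \<Phi> c d) C) = (cst (star \<Phi> C))(c := cst C d)"
    by (auto simp: univ_star rel_star cst_star expand_cst_def fun_eq_iff)
  ultimately show ?thesis by (auto simp: agree_def)
qed

lemma agree_star_expand_rel:
  assumes "transduction L (rich_vocab \<tau>) \<tau> \<Phi>" "R \<notin> rels \<tau>" and M: "M = star \<Phi> (rich_union A B)"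
  shows "agree (add_rel \<tau> R) (star (expand_rel \<Phi> R) (rich_union (set_rel A R V) (set_rel B R W)))
    (set_rel M R ((map inl ` V \<union> map inr ` W) \<inter> tuples (univ M) (arity R)))"
proof -
  let ?C = "rich_union (set_rel A R V) (set_rel B R W)"
  let ?N = "star (expand_rel \<Phi> R) ?C"
  have "agree (rich_vocab \<tau>) ?C (rich_union A B)"
    using assms(2) by (auto simp: agree_def)
  then have agree_M: "agree \<tau> (star \<Phi> ?C) M"
    unfolding M using assms(1) by (rule agree_star)
  have univ: "univ ?N = univ (star \<Phi> ?C)"
    by (simp add: univ_star expand_rel_def)
  moreover have "rel ?N R' = rel (star \<Phi> ?C) R'" if "R' \<noteq> R" for R'
    unfolding rel_star univ using that by (simp add: expand_rel_def)
  moreover have "rel ?N R = (map inl ` V \<union> map inr ` W) \<inter> tuples (univ (star \<Phi> ?C)) (arity R)"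
  proof -
    have "rel ?N R = {as \<in> tuples (univ (star \<Phi> ?C)) (arity R). as \<in> rel ?C (RIn R)}"
      unfolding rel_star univ by (auto simp: expand_rel_def holds_rel_form tuples_def)
    then show ?thesis by auto
  qed
  moreover have "cst ?N = cst (star \<Phi> ?C)"
    by (auto simp: cst_star expand_rel_def)
  ultimately show ?thesis using agree_M by (auto simp: agree_def)
qed


section \<open>Pulling back along a transduction\<close>

text \<open>
  \<open>star \<Phi>\<close> may map a constant to an element outside of the new universe. Such results, which are not
  structures, get the value zero, so that they do not contribute to sums over expansions.
\<close>

definition pullback :: "vocab \<Rightarrow> transd \<Rightarrow> (struct \<Rightarrow> 'a::zero) \<Rightarrow> struct \<Rightarrow> struct \<Rightarrow> 'a" where
  "pullback \<tau> \<Phi> v A B =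
     (if cst_closed \<tau> (star \<Phi> (rich_union A B)) then v (star \<Phi> (rich_union A B)) else 0)"

definition agree_invariant :: "vocab \<Rightarrow> (struct \<Rightarrow> 'a) \<Rightarrow> bool" where
  "agree_invariant \<tau> v \<longleftrightarrow>
     (\<forall>M N. agree \<tau> M N \<longrightarrow> cst_closed \<tau> M \<longrightarrow> finite (univ M) \<longrightarrow> v M = v N)"

lemma agree_invariant_lpoly_val: "is_lpoly L \<tau> P \<Longrightarrow> agree_invariant \<tau> (\<lambda>M. lpoly_val M P)"
  unfolding agree_invariant_def using lpoly_val_agree by blast

lemma pullback_agree:
  assumes "agree_invariant \<tau> v" "A \<in> Str \<tau>" "B \<in> Str \<tau>" "agree \<tau> (star \<Phi> (rich_union A B)) N"
  shows "pullback \<tau> \<Phi> v A B = (if cst_closed \<tau> N then v N else 0)"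
  using assms(1,4) cst_closed_agree[OF assms(4)] finite_univ_star[OF assms(2,3), of \<Phi>]
  by (auto simp: pullback_def agree_invariant_def)

lemma pullback_expand_cst:
  assumes "transduction L (rich_vocab \<tau>) \<tau> \<Phi>" "c \<notin> csts \<tau>" "agree_invariant (add_cst \<tau> c) v"
    and "A \<in> Str \<tau>" "B \<in> Str \<tau>" "x \<in> univ A" "y \<in> univ B" and "M = star \<Phi> (rich_union A B)"
    and "a = cst (rich_union (set_cst A c x) (set_cst B c y)) d"
  shows "pullback (add_cst \<tau> c) (expand_cst \<Phi> c d) v (set_cst A c x) (set_cst B c y) =
    (if cst_closed \<tau> M \<and> a \<in> univ M then v (set_cst M c a) else 0)"
  unfolding cst_closed_set_cst[OF assms(2), symmetric] assms(8,9)
  by (intro pullback_agree[OF assms(3)] agree_star_expand_cst[OF assms(1,2) refl]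
      set_cst_in_Str assms(4-7))

lemma pullback_expand_rel:
  assumes "transduction L (rich_vocab \<tau>) \<tau> \<Phi>" "R \<notin> rels \<tau>" "agree_invariant (add_rel \<tau> R) v"
    and "A \<in> Str \<tau>" "B \<in> Str \<tau>" "V \<subseteq> tuples (univ A) (arity R)" "W \<subseteq> tuples (univ B) (arity R)"
    and M: "M = star \<Phi> (rich_union A B)"
    and Z: "Z = map inl ` V \<union> map inr ` W" "Z \<subseteq> tuples (univ M) (arity R)"
  shows "pullback (add_rel \<tau> R) (expand_rel \<Phi> R) v (set_rel A R V) (set_rel B R W) =
    (if cst_closed \<tau> M then v (set_rel M R Z) else 0)"
proof -
  have "agree (add_rel \<tau> R) (star (expand_rel \<Phi> R) (rich_union (set_rel A R V) (set_rel B R W)))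
      (set_rel M R Z)"
    using agree_star_expand_rel[OF assms(1,2) M, of V W] Z by (simp add: Int_absorb2)
  then show ?thesis
    unfolding cst_closed_set_rel[of \<tau> R M Z, symmetric]
    by (intro pullback_agree[OF assms(3)] set_rel_in_Str assms(4-7))
qed

lemma pullback_sum_cst:
  assumes "transduction L (rich_vocab \<tau>) \<tau> \<Phi>" "c \<notin> csts \<tau>" "agree_invariant (add_cst \<tau> c) v"
    and "A \<in> Str \<tau>" "B \<in> Str \<tau>" "x0 \<in> univ A" "y0 \<in> univ B"
  defines "h d \<equiv> pullback (add_cst \<tau> c) (expand_cst \<Phi> c d) v"
  shows "pullback \<tau> \<Phi> (\<lambda>M. \<Sum>a\<in>univ M. v (set_cst M c a)) A B =
    (\<Sum>x\<in>univ A. h (CLeft c) (set_cst A c x) (set_cst B c y0)) +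
    (\<Sum>y\<in>univ B. h (CRight c) (set_cst A c x0) (set_cst B c y))"
  using assms(6,7)
  by (simp add: h_def pullback_expand_cst[OF assms(1-5) _ _ refl refl] pullback_def[of \<tau>]
      sum.split_univ_star[OF assms(4,5) refl] cong: if_cong)

lemma mono_val_ProdC_star:
  assumes "A \<in> Str \<tau>" "B \<in> Str \<tau>" "M = star \<Phi> (rich_union A B)"
  shows "mono_val M (ProdC c \<phi> t) =
    (\<Prod>x\<in>univ A. if inl x \<in> univ M \<and> models (set_cst M c (inl x)) \<phi> then smono_val t else 1) *
    (\<Prod>y\<in>univ B. if inr y \<in> univ M \<and> models (set_cst M c (inr y)) \<phi> then smono_val t else 1)"
proof -
  have "mono_val M (ProdC c \<phi> t) = (\<Prod>a\<in>univ M. if models (set_cst M c a) \<phi> then smono_val t else 1)"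
    using finite_univ_star[OF assms(1,2)]
    by (simp add: assms(3) prod.inter_filter del: prod_constant)
  then show ?thesis by (simp add: prod.split_univ_star[OF assms] if_if_eq_conj)
qed


section \<open>Definability of the guards\<close>

text \<open>
  Fragments need not be closed under substituting a constant into a formula, so a guarded quantifier
  is needed to say that the value of a constant lies in the new universe.
\<close>

definition guard :: "transd \<Rightarrow> form \<Rightarrow> form" where
  "guard \<Phi> \<phi> = All 0 (Imp \<phi> (t_univ \<Phi>))"

lemma models_All_Imp:
  assumes "param_form L \<tau> 1 \<phi>" "param_form L \<tau> 1 \<psi>"
  shows "models C (All 0 (Imp \<phi> \<psi>)) \<longleftrightarrow> (\<forall>a\<in>univ C. holds C \<phi> [a] \<longrightarrow> holds C \<psi> [a])"
proof -
  have "sat C (((!) [])(0 := a)) (\<lambda>_. {}) \<chi> = holds C \<chi> [a]" if "param_form L \<tau> 1 \<chi>" for \<chi> a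
    unfolding holds_def by (rule sat_cong) (use param_formD[OF that] in auto)
  then show ?thesis using assms by (auto simp: holds_def)
qed

lemma models_guard:
  assumes "transduction L \<tau> \<sigma> \<Phi>" "param_form L \<tau> 1 \<phi>"
  shows "models C (guard \<Phi> \<phi>) \<longleftrightarrow> (\<forall>a\<in>univ C. holds C \<phi> [a] \<longrightarrow> a \<in> univ (star \<Phi> C))"
  unfolding guard_def models_All_Imp[OF assms(2) transductionD(1)[OF assms(1)]]
  by (simp add: univ_star)

context tame_fragment
begin

lemma param_form_Eq: "vocabulary \<tau> \<Longrightarrow> d \<in> csts \<tau> \<Longrightarrow> param_form L \<tau> 1 (Eq (Var 0) (Const d))"
  using Eq_closed[of \<tau> "Var 0" "Const d"] by (simp add: param_form_def Lang_def)

lemma param_form_rel_form: "vocabulary \<tau> \<Longrightarrow> R \<in> rels \<tau> \<Longrightarrow> param_form L \<tau> (arity R) (rel_form R)"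
  using Rel_closed[of \<tau> R "map Var [0..<arity R]"]
  by (auto simp: param_form_def Lang_def rel_form_def)

lemma param_form_Conj:
  "vocabulary \<tau> \<Longrightarrow> param_form L \<tau> k \<phi> \<Longrightarrow> param_form L \<tau> k \<psi> \<Longrightarrow> param_form L \<tau> k (Conj \<phi> \<psi>)"
  using Conj_closed[of \<tau> \<phi> \<psi>] by (simp add: param_form_def Lang_def)

lemma sentence_All_Imp:
  "vocabulary \<tau> \<Longrightarrow> param_form L \<tau> 1 \<phi> \<Longrightarrow> param_form L \<tau> 1 \<psi> \<Longrightarrow> sentence L \<tau> (All 0 (Imp \<phi> \<psi>))"
  using All_Imp_closed[of \<tau> \<phi> \<psi>] by (auto simp: param_form_def Lang_def)

lemma sentence_Ball:
  assumes "vocabulary \<tau>" "finite K" "\<And>k. k \<in> K \<Longrightarrow> sentence L \<tau> (\<psi> k)"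
  shows "\<exists>\<theta>. sentence L \<tau> \<theta> \<and> (\<forall>C. models C \<theta> \<longleftrightarrow> (\<forall>k\<in>K. models C (\<psi> k)))"
  using assms(2,3)
proof (induction K rule: finite_induct)
  case empty
  let ?eq = "Eq (Var 0) (Var 0)"
  have "param_form L \<tau> 1 ?eq" using Eq_closed[OF assms(1), of "Var 0" "Var 0"]
    by (simp add: param_form_def Lang_def)
  then have "sentence L \<tau> (All 0 (Imp ?eq ?eq))" by (intro sentence_All_Imp assms(1))
  then show ?case by (intro exI[of _ "All 0 (Imp ?eq ?eq)"]) (simp add: holds_def)
next
  case (insert k K)
  then obtain \<theta> where "sentence L \<tau> \<theta>" "\<forall>C. models C \<theta> \<longleftrightarrow> (\<forall>k\<in>K. models C (\<psi> k))" by auto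
  then show ?case
    using insert.prems
    by (intro exI[of _ "Conj (\<psi> k) \<theta>"]) (auto simp: holds_def intro: param_form_Conj assms(1))
qed

lemma sentence_guard:
  "vocabulary \<tau> \<Longrightarrow> transduction L \<tau> \<sigma> \<Phi> \<Longrightarrow> param_form L \<tau> 1 \<phi> \<Longrightarrow> sentence L \<tau> (guard \<Phi> \<phi>)"
  unfolding guard_def by (intro sentence_All_Imp transductionD(1))

lemma models_guard_Eq:
  assumes "transduction L \<tau> \<sigma> \<Phi>" "vocabulary \<tau>" "d \<in> csts \<tau>" "cst C d \<in> univ C"
  shows "models C (guard \<Phi> (Eq (Var 0) (Const d))) \<longleftrightarrow> cst C d \<in> univ (star \<Phi> C)"
proof -
  have "holds C (Eq (Var 0) (Const d)) [a] \<longleftrightarrow> a = cst C d" for a by (simp add: holds_def)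
  then show ?thesis using assms(4)
    by (auto simp: models_guard[OF assms(1) param_form_Eq[OF assms(2,3)]])
qed

lemma models_guard_rel_form:
  assumes "transduction L \<tau> \<sigma> \<Phi>" "vocabulary \<tau>" "R \<in> rels \<tau>" "arity R = 1"
    and "rel C R \<subseteq> tuples (univ C) 1"
  shows "models C (guard \<Phi> (rel_form R)) \<longleftrightarrow> rel C R \<subseteq> tuples (univ (star \<Phi> C)) 1"
proof -
  have "param_form L \<tau> 1 (rel_form R)" using param_form_rel_form[OF assms(2,3)] assms(4) by simp
  from models_guard[OF assms(1) this] show ?thesis
    using assms(4,5) by (auto simp: holds_rel_form tuples_1)
qed

lemma sentence_cst_closed_star:
  assumes "vocabulary \<tau>" "vocabulary \<sigma>" "transduction L \<tau> \<sigma> \<Phi>"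
  obtains \<theta> where "sentence L \<tau> \<theta>"
    and "\<And>C. cst_closed \<tau> C \<Longrightarrow> models C \<theta> \<longleftrightarrow> cst_closed \<sigma> (star \<Phi> C)"
proof -
  let ?\<psi> = "\<lambda>c. guard \<Phi> (Eq (Var 0) (Const (t_cst \<Phi> c)))"
  note t_cst = transductionD(3)[OF assms(3)]
  have "finite (csts \<sigma>)" using assms(2) by (simp add: vocabulary_def)
  moreover have "sentence L \<tau> (?\<psi> c)" if "c \<in> csts \<sigma>" for c
    by (intro sentence_guard[OF assms(1,3)] param_form_Eq assms(1) t_cst that)
  ultimately obtain \<theta> where \<theta>: "sentence L \<tau> \<theta>" "\<And>C. models C \<theta> \<longleftrightarrow> (\<forall>c\<in>csts \<sigma>. models C (?\<psi> c))"
    using sentence_Ball[OF assms(1), of "csts \<sigma>" ?\<psi>] by blast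
  have "models C \<theta> \<longleftrightarrow> cst_closed \<sigma> (star \<Phi> C)" if "cst_closed \<tau> C" for C
    using that t_cst
    by (simp add: \<theta>(2) models_guard_Eq[OF assms(3,1)] cst_closed_def cst_star cong: ball_cong)
  with \<theta>(1) show ?thesis by (rule that)
qed

lemma transduction_expand_rel:
  assumes "vocabulary \<tau>" "transduction L (rich_vocab \<tau>) \<tau> \<Phi>"
  shows "transduction L (rich_vocab (add_rel \<tau> R)) (add_rel \<tau> R) (expand_rel \<Phi> R)"
proof -
  have "param_form L (rich_vocab \<tau>) k \<phi> \<Longrightarrow> param_form L (rich_vocab (add_rel \<tau> R)) k \<phi>" for k \<phi>
    by (erule param_form_mono) auto
  moreover have "param_form L (rich_vocab (add_rel \<tau> R)) (arity R) (rel_form (RIn R))"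
    using param_form_rel_form[of "rich_vocab (add_rel \<tau> R)" "RIn R"] assms(1)
    by (simp add: vocabulary_rich_vocab vocabulary_add_rels)
  ultimately show ?thesis using assms(2) by (auto simp: transduction_def expand_rel_def)
qed

lemma models_guard_expand_rel:
  assumes "vocabulary \<tau>" "transduction L (rich_vocab \<tau>) \<tau> \<Phi>" "R \<notin> rels \<tau>" "arity R = 1"
    and VW: "V \<subseteq> tuples (univ A) 1" "W \<subseteq> tuples (univ B) 1"
  shows "models (rich_union (set_rel A R V) (set_rel B R W))
      (guard (expand_rel \<Phi> R) (rel_form (RIn R))) \<longleftrightarrow>
    map inl ` V \<union> map inr ` W \<subseteq> tuples (univ (star \<Phi> (rich_union A B))) 1"
proof -
  let ?\<tau> = "rich_vocab (add_rel \<tau> R)" and ?C = "rich_union (set_rel A R V) (set_rel B R W)"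
  have "rel ?C (RIn R) \<subseteq> tuples (univ ?C) 1" using VW by (fastforce simp: tuples_1)
  moreover have "vocabulary ?\<tau>" by (intro vocabulary_rich_vocab vocabulary_add_rels assms(1))
  moreover have "univ (star (expand_rel \<Phi> R) ?C) = univ (star \<Phi> (rich_union A B))"
    using agree_star_expand_rel[OF assms(2,3) refl, of A V B W] by (simp add: agree_def)
  ultimately show ?thesis
    using models_guard_rel_form[OF transduction_expand_rel[OF assms(1,2)], of R "RIn R" ?C] assms(4)
    by simp
qed

lemma pullback_sum_unary_rel:
  fixes v :: "struct \<Rightarrow> 'a::semiring_1"
  assumes "vocabulary \<tau>" "transduction L (rich_vocab \<tau>) \<tau> \<Phi>" "R \<notin> rels \<tau>" "arity R = 1"
    and "agree_invariant (add_rel \<tau> R) v" and AB: "A \<in> Str \<tau>" "B \<in> Str \<tau>"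
  defines "\<gamma> \<equiv> guard (expand_rel \<Phi> R) (rel_form (RIn R))"
  shows "pullback \<tau> \<Phi> (\<lambda>M. \<Sum>Z\<in>Pow (tuples (univ M) 1). v (set_rel M R Z)) A B =
    (\<Sum>V\<in>Pow (tuples (univ A) 1). \<Sum>W\<in>Pow (tuples (univ B) 1).
      of_bool (models (rich_union (set_rel A R V) (set_rel B R W)) \<gamma>) *
      pullback (add_rel \<tau> R) (expand_rel \<Phi> R) v (set_rel A R V) (set_rel B R W))"
proof -
  define M where "M = star \<Phi> (rich_union A B)"
  define g where "g Z = (if cst_closed \<tau> M then v (set_rel M R Z) else 0)" for Z
  let ?T = "\<lambda>A. tuples (univ A) 1" and ?Z = "\<lambda>V W. map inl ` V \<union> map inr ` W"
  have summand: "of_bool (models (rich_union (set_rel A R V) (set_rel B R W)) \<gamma>) *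
      pullback (add_rel \<tau> R) (expand_rel \<Phi> R) v (set_rel A R V) (set_rel B R W) =
      (if ?Z V W \<subseteq> ?T M then g (?Z V W) else 0)" if "V \<in> Pow (?T A)" "W \<in> Pow (?T B)" for V W
    using that models_guard_expand_rel[OF assms(1-4), of V A W B]
      pullback_expand_rel[OF assms(2,3,5) AB _ _ M_def refl, of V W]
    by (simp add: \<gamma>_def g_def M_def assms(4))
  have "pullback \<tau> \<Phi> (\<lambda>M. \<Sum>Z\<in>Pow (?T M). v (set_rel M R Z)) A B = (\<Sum>Z\<in>Pow (?T M). g Z)"
    by (simp add: pullback_def g_def M_def)
  also have "\<dots> = (\<Sum>V\<in>Pow (?T A). \<Sum>W\<in>Pow (?T B). if ?Z V W \<subseteq> ?T M then g (?Z V W) else 0)"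
    by (rule sum_Pow_tuples_star[OF AB M_def])
  finally show ?thesis by (simp only: summand cong: sum.cong)
qed

lemma sentence_models_expand_cst:
  assumes "vocabulary \<tau>" "transduction L (rich_vocab \<tau>) \<tau> \<Phi>" "c \<notin> csts \<tau>"
    and "sentence L (add_cst \<tau> c) \<phi>" "d \<in> {CLeft c, CRight c}"
  shows "\<exists>\<theta>. sentence L (rich_vocab (add_cst \<tau> c)) \<theta> \<and>
    (\<forall>A\<in>Str \<tau>. \<forall>B\<in>Str \<tau>. \<forall>x\<in>univ A. \<forall>y\<in>univ B.
      let M = star \<Phi> (rich_union A B); C = rich_union (set_cst A c x) (set_cst B c y)
      in models C \<theta> \<longleftrightarrow> cst_closed \<tau> M \<and> cst C d \<in> univ M \<and> models (set_cst M c (cst C d)) \<phi>)"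
proof -
  let ?\<tau> = "add_cst \<tau> c" and ?\<Phi> = "expand_cst \<Phi> c d"
  have voc: "vocabulary ?\<tau>" "vocabulary (rich_vocab ?\<tau>)"
    by (intro vocabulary_add_csts vocabulary_rich_vocab assms(1))+
  note \<Phi> = transduction_expand_cst[OF assms(2,5)]
  obtain \<chi> where \<chi>: "sentence L (rich_vocab ?\<tau>) \<chi>"
    "\<And>C. cst_closed (rich_vocab ?\<tau>) C \<Longrightarrow> models C \<chi> \<longleftrightarrow> cst_closed ?\<tau> (star ?\<Phi> C)"
    using sentence_cst_closed_star[OF voc(2,1) \<Phi>] by blast
  let ?\<theta> = "Conj \<chi> (sharp ?\<Phi> \<phi>)"
  have "models C ?\<theta> \<longleftrightarrow> cst_closed \<tau> M \<and> cst C d \<in> univ M \<and> models (set_cst M c (cst C d)) \<phi>"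
    if A: "A \<in> Str \<tau>" "x \<in> univ A" and B: "B \<in> Str \<tau>" "y \<in> univ B"
      and M: "M = star \<Phi> (rich_union A B)" and C: "C = rich_union (set_cst A c x) (set_cst B c y)"
    for A B x y M C
  proof -
    have agree_C: "agree ?\<tau> (star ?\<Phi> C) (set_cst M c (cst C d))"
      unfolding M by (rule agree_star_expand_cst[OF assms(2,3) C])
    have "cst_closed (rich_vocab ?\<tau>) C"
      unfolding C by (intro cst_closed_rich_union set_cst_in_Str A B)
    then have "models C ?\<theta> \<longleftrightarrow> cst_closed ?\<tau> (star ?\<Phi> C) \<and> models (star ?\<Phi> C) \<phi>"
      using \<chi>(2) models_sharp[OF \<Phi> _ assms(4)] by (auto simp: holds_def)
    then show ?thesis
      by (simp add: cst_closed_agree[OF agree_C] models_agree[OF agree_C assms(4)]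
          cst_closed_set_cst[OF assms(3)])
  qed
  moreover have "sentence L (rich_vocab ?\<tau>) ?\<theta>"
    by (intro param_form_Conj sentence_sharp[OF _ _ \<Phi>] voc \<chi>(1) assms(4))
  ultimately show ?thesis by (auto simp: Let_def)
qed

end


section \<open>Types of bounded quantifier rank\<close>

definition dummy :: "struct \<Rightarrow> nat" where
  "dummy A = (SOME a. a \<in> univ A)"

lemma dummy_in_univ: "A \<in> Str \<tau> \<Longrightarrow> dummy A \<in> univ A"
  by (auto simp: dummy_def Str_def some_in_eq)

lemma models_equivalent:
  assumes "equivalent \<tau> \<phi> \<chi>" "sentence L \<tau> \<phi>" "A \<in> Str \<tau>"
  shows "models A \<phi> = sat A (\<lambda>_. dummy A) (\<lambda>_. {}) \<chi>"
proof -
  have "models A \<phi> = sat A (\<lambda>_. dummy A) (\<lambda>_. {}) \<phi>"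
    unfolding holds_def by (rule sat_cong) (use param_formD[OF assms(2)] in auto)
  also have "\<dots> = sat A (\<lambda>_. dummy A) (\<lambda>_. {}) \<chi>"
    using assms(1,3) dummy_in_univ[OF assms(3)] by (simp add: equivalent_def image_subset_iff)
  finally show ?thesis .
qed

context fragment
begin

definition qtype :: "vocab \<Rightarrow> nat \<Rightarrow> struct \<Rightarrow> form set" where
  "qtype \<tau> q A = {\<phi>. sentence L \<tau> \<phi> \<and> qr \<phi> \<le> q \<and> models A \<phi>}"

lemma q_equiv_iff_qtype_eq: "q_equiv L qr \<tau> q A B \<longleftrightarrow> qtype \<tau> q A = qtype \<tau> q B"
  by (auto simp: q_equiv_def qtype_def)

lemma finite_qtypes:
  assumes "vocabulary \<tau>"
  shows "finite (qtype \<tau> q ` Str \<tau>)"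
proof -
  obtain F where F: "finite F" "\<And>\<phi>. sentence L \<tau> \<phi> \<Longrightarrow> qr \<phi> \<le> q \<Longrightarrow> \<exists>\<chi>\<in>F. equivalent \<tau> \<phi> \<chi>"
    using finitely_many[OF assms, of "{}" "{}" q] by (auto simp: param_form_def)
  define trace where "trace A = {\<chi>\<in>F. sat A (\<lambda>_. dummy A) (\<lambda>_. {}) \<chi>}" for A
  define type_of where "type_of X = {\<phi>. sentence L \<tau> \<phi> \<and> qr \<phi> \<le> q \<and> (\<exists>\<chi>\<in>X. equivalent \<tau> \<phi> \<chi>)}" for X
  have "qtype \<tau> q A = type_of (trace A)" if "A \<in> Str \<tau>" for A
    using F(2) models_equivalent[OF _ _ that] by (fastforce simp: qtype_def type_of_def trace_def)
  then have "qtype \<tau> q ` Str \<tau> \<subseteq> type_of ` Pow F" by (auto simp: trace_def)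
  then show ?thesis by (rule finite_subset) (simp add: F(1))
qed

end

locale smooth_fragment = tame_fragment +
  assumes rich_union_smooth: "rich_union_smooth L qr"
begin

lemma models_rich_union_qtypes:
  assumes "vocabulary \<tau>" "sentence L (rich_vocab \<tau>) \<theta>"
  obtains Q where "\<And>A B. A \<in> Str \<tau> \<Longrightarrow> B \<in> Str \<tau> \<Longrightarrow>
    models (rich_union A B) \<theta> \<longleftrightarrow> Q (qtype \<tau> (qr \<theta>) A) (qtype \<tau> (qr \<theta>) B)"
proof -
  let ?T = "qtype \<tau> (qr \<theta>)"
  have models_eq: "models (rich_union A B) \<theta> = models (rich_union A' B') \<theta>"
    if "A \<in> Str \<tau>" "B \<in> Str \<tau>" "A' \<in> Str \<tau>" "B' \<in> Str \<tau>" "?T A = ?T A'" "?T B = ?T B'" for A B A' B'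
  proof -
    have "smooth L qr \<tau> (rich_vocab \<tau>) rich_union"
      using rich_union_smooth assms(1) by (simp add: rich_union_smooth_def)
    moreover have "q_equiv L qr \<tau> (qr \<theta>) A A'" "q_equiv L qr \<tau> (qr \<theta>) B B'"
      using that by (simp_all add: q_equiv_iff_qtype_eq)
    ultimately have "q_equiv L qr (rich_vocab \<tau>) (qr \<theta>) (rich_union A B) (rich_union A' B')"
      using that(1-4) unfolding smooth_def by blast
    then show ?thesis using assms(2) by (auto simp: q_equiv_def)
  qed
  define Q where "Q t u \<longleftrightarrow>
    (\<exists>A\<in>Str \<tau>. \<exists>B\<in>Str \<tau>. t = ?T A \<and> u = ?T B \<and> models (rich_union A B) \<theta>)" for t u
  show thesis
    by (rule that[of Q]) (use models_eq in \<open>unfold Q_def, blast\<close>)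
qed

lemma separable_models_rich_union:
  assumes "vocabulary \<tau>" "sentence L (rich_vocab \<tau>) \<theta>"
  shows "separable (Str \<tau>) (Str \<tau>) (\<lambda>A B. k (models (rich_union A B) \<theta>))"
proof -
  obtain Q where Q: "\<And>A B. A \<in> Str \<tau> \<Longrightarrow> B \<in> Str \<tau> \<Longrightarrow>
      models (rich_union A B) \<theta> \<longleftrightarrow> Q (qtype \<tau> (qr \<theta>) A) (qtype \<tau> (qr \<theta>) B)"
    using models_rich_union_qtypes[OF assms] by blast
  have "separable (Str \<tau>) (Str \<tau>) (\<lambda>A B. k (Q (qtype \<tau> (qr \<theta>) A) (qtype \<tau> (qr \<theta>) B)))"
    by (rule separable_finite_range_left[OF finite_qtypes[OF assms(1)]])
  then show ?thesis by (rule separable_cong) (simp add: Q)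
qed

lemma separable_prod_models_expand_cst:
  assumes "vocabulary \<tau>" "sentence L (rich_vocab (add_cst \<tau> c)) \<theta>"
  shows "separable (Str \<tau>) (Str \<tau>)
      (\<lambda>A B. \<Prod>x\<in>univ A. k (models (rich_union (set_cst A c x) (set_cst B c (dummy B))) \<theta>))"
    and "separable (Str \<tau>) (Str \<tau>)
      (\<lambda>A B. \<Prod>y\<in>univ B. k (models (rich_union (set_cst A c (dummy A)) (set_cst B c y)) \<theta>))"
proof -
  let ?\<tau> = "add_cst \<tau> c"
  let ?T = "\<lambda>A x. qtype ?\<tau> (qr \<theta>) (set_cst A c x)"
  have voc: "vocabulary ?\<tau>" by (rule vocabulary_add_csts[OF assms(1)])
  obtain Q where "\<And>A B. A \<in> Str ?\<tau> \<Longrightarrow> B \<in> Str ?\<tau> \<Longrightarrow>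
      models (rich_union A B) \<theta> \<longleftrightarrow> Q (qtype ?\<tau> (qr \<theta>) A) (qtype ?\<tau> (qr \<theta>) B)"
    using models_rich_union_qtypes[OF voc assms(2)] by blast
  then have Q: "models (rich_union (set_cst A c x) (set_cst B c y)) \<theta> \<longleftrightarrow> Q (?T A x) (?T B y)"
    if "A \<in> Str \<tau>" "B \<in> Str \<tau>" "x \<in> univ A" "y \<in> univ B" for A B x y
    using that by (simp add: set_cst_in_Str)
  have "(\<lambda>A. ?T A (dummy A)) ` Str \<tau> \<subseteq> qtype ?\<tau> (qr \<theta>) ` Str ?\<tau>"
    using set_cst_in_Str dummy_in_univ by blast
  then have finite_dummy_types: "finite ((\<lambda>A. ?T A (dummy A)) ` Str \<tau>)"
    using finite_qtypes[OF voc] by (rule finite_subset)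
  have "separable (Str \<tau>) (Str \<tau>) (\<lambda>A B. \<Prod>x\<in>univ A. k (Q (?T A x) (?T B (dummy B))))"
    by (rule separable_finite_range_right[OF finite_dummy_types])
  then show "separable (Str \<tau>) (Str \<tau>)
      (\<lambda>A B. \<Prod>x\<in>univ A. k (models (rich_union (set_cst A c x) (set_cst B c (dummy B))) \<theta>))"
    by (rule separable_cong) (simp add: Q dummy_in_univ)
  have "separable (Str \<tau>) (Str \<tau>) (\<lambda>A B. \<Prod>y\<in>univ B. k (Q (?T A (dummy A)) (?T B y)))"
    by (rule separable_finite_range_left[OF finite_dummy_types])
  then show "separable (Str \<tau>) (Str \<tau>)
      (\<lambda>A B. \<Prod>y\<in>univ B. k (models (rich_union (set_cst A c (dummy A)) (set_cst B c y)) \<theta>))"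
    by (rule separable_cong) (simp add: Q dummy_in_univ)
qed


section \<open>Separability of definable polynomials\<close>

definition star_separable :: "vocab \<Rightarrow> transd \<Rightarrow> (struct \<Rightarrow> 'a::comm_semiring_1) \<Rightarrow> bool" where
  "star_separable \<tau> \<Phi> v \<longleftrightarrow> separable (Str \<tau>) (Str \<tau>) (pullback \<tau> \<Phi> v)"

lemma star_separable_const:
  assumes "vocabulary \<tau>" "transduction L (rich_vocab \<tau>) \<tau> \<Phi>"
  shows "star_separable \<tau> \<Phi> (\<lambda>_. k)"
proof -
  obtain \<theta> where \<theta>: "sentence L (rich_vocab \<tau>) \<theta>" and models_\<theta>: "\<And>C. cst_closed (rich_vocab \<tau>) C \<Longrightarrow>
      models C \<theta> \<longleftrightarrow> cst_closed \<tau> (star \<Phi> C)"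
    using sentence_cst_closed_star[OF vocabulary_rich_vocab[OF assms(1)] assms] by blast
  show ?thesis
    unfolding star_separable_def
    by (rule separable_cong[OF separable_models_rich_union[OF assms(1) \<theta>,
            of "\<lambda>b. if b then k else 0"]])
      (simp add: pullback_def models_\<theta> cst_closed_rich_union)
qed

lemma star_separable_mult:
  assumes "star_separable \<tau> \<Phi> v" "star_separable \<tau> \<Phi> w"
  shows "star_separable \<tau> \<Phi> (\<lambda>M. v M * w M)"
  unfolding star_separable_def
  by (rule separable_cong[OF separable_mult[OF assms[unfolded star_separable_def]]])
    (simp add: pullback_def)

lemma star_separable_if_models:
  assumes "vocabulary \<tau>" "transduction L (rich_vocab \<tau>) \<tau> \<Phi>" "sentence L \<tau> \<phi>" "star_separable \<tau> \<Phi> v"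
  shows "star_separable \<tau> \<Phi> (\<lambda>M. if models M \<phi> then v M else 0)"
proof -
  have "sentence L (rich_vocab \<tau>) (sharp \<Phi> \<phi>)"
    by (intro sentence_sharp[OF _ _ assms(2)] vocabulary_rich_vocab assms(1,3))
  note sep = separable_models_rich_union[OF assms(1) this, of of_bool]
  show ?thesis
    unfolding star_separable_def
    by (rule separable_cong[OF separable_mult[OF sep assms(4)[unfolded star_separable_def]]])
      (simp add: pullback_def models_sharp[OF assms(2) _ assms(3)])
qed

lemma star_separable_ProdC:
  assumes "vocabulary \<tau>" "transduction L (rich_vocab \<tau>) \<tau> \<Phi>" "is_mono L \<tau> (ProdC c \<phi> t)"
  shows "star_separable \<tau> \<Phi> (\<lambda>M. mono_val M (ProdC c \<phi> t))"
proof -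
  let ?C = "\<lambda>A x B y. rich_union (set_cst A c x) (set_cst B c y)"
  let ?k = "\<lambda>b. if b then smono_val t else 1"
  have c_new: "c \<notin> csts \<tau>" and \<phi>: "sentence L (add_cst \<tau> c) \<phi>" using assms(3) by auto
  obtain \<theta>\<^sub>l \<theta>\<^sub>r where \<theta>: "sentence L (rich_vocab (add_cst \<tau> c)) \<theta>\<^sub>l"
      "sentence L (rich_vocab (add_cst \<tau> c)) \<theta>\<^sub>r"
    and models_\<theta>: "\<And>A B x y M. A \<in> Str \<tau> \<Longrightarrow> B \<in> Str \<tau> \<Longrightarrow> x \<in> univ A \<Longrightarrow> y \<in> univ B \<Longrightarrow>
      M = star \<Phi> (rich_union A B) \<Longrightarrow> cst_closed \<tau> M \<Longrightarrow>
      (models (?C A x B y) \<theta>\<^sub>l \<longleftrightarrow> inl x \<in> univ M \<and> models (set_cst M c (inl x)) \<phi>) \<and>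
      (models (?C A x B y) \<theta>\<^sub>r \<longleftrightarrow> inr y \<in> univ M \<and> models (set_cst M c (inr y)) \<phi>)"
    using sentence_models_expand_cst[OF assms(1,2) c_new \<phi>, of "CLeft c"]
      sentence_models_expand_cst[OF assms(1,2) c_new \<phi>, of "CRight c"]
    by (auto simp: Let_def)
  have "separable (Str \<tau>) (Str \<tau>) (\<lambda>A B. pullback \<tau> \<Phi> (\<lambda>_. 1) A B *
      ((\<Prod>x\<in>univ A. ?k (models (?C A x B (dummy B)) \<theta>\<^sub>l)) *
       (\<Prod>y\<in>univ B. ?k (models (?C A (dummy A) B y) \<theta>\<^sub>r))))"
    by (intro separable_mult separable_prod_models_expand_cst[OF assms(1)] \<theta>
        star_separable_const[OF assms(1,2), unfolded star_separable_def])
  then show ?thesis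
    unfolding star_separable_def
    by (rule separable_cong)
      (simp add: pullback_def mono_val_ProdC_star[OF _ _ refl] models_\<theta> dummy_in_univ
        del: mono_val.simps)
qed

lemma star_separable_mono:
  assumes "vocabulary \<tau>" "transduction L (rich_vocab \<tau>) \<tau> \<Phi>" "is_mono L \<tau> m"
  shows "star_separable \<tau> \<Phi> (\<lambda>M. mono_val M m)"
  using assms(3)
proof (induction m)
  case (Simple t)
  show ?case by (simp add: star_separable_const[OF assms(1,2)])
next
  case (ProdC c \<phi> t)
  then show ?case by (rule star_separable_ProdC[OF assms(1,2)])
next
  case (Times m n)
  then show ?case by (simp add: star_separable_mult)
qed

lemma star_separable_sum_cst:
  assumes "transduction L (rich_vocab \<tau>) \<tau> \<Phi>" "c \<notin> csts \<tau>" "agree_invariant (add_cst \<tau> c) v"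
    and "star_separable (add_cst \<tau> c) (expand_cst \<Phi> c (CLeft c)) v"
    and "star_separable (add_cst \<tau> c) (expand_cst \<Phi> c (CRight c)) v"
  shows "star_separable \<tau> \<Phi> (\<lambda>M. \<Sum>a\<in>univ M. v (set_cst M c a))"
proof -
  let ?h = "\<lambda>d. pullback (add_cst \<tau> c) (expand_cst \<Phi> c d) v"
  have "separable (Str \<tau>) (Str \<tau>) (\<lambda>A B.
      (\<Sum>x\<in>univ A. \<Sum>y\<in>{dummy B}. ?h (CLeft c) (set_cst A c x) (set_cst B c y)) +
      (\<Sum>x\<in>{dummy A}. \<Sum>y\<in>univ B. ?h (CRight c) (set_cst A c x) (set_cst B c y)))"
    by (intro separable_add separable_double_sum[OF assms(4)[unfolded star_separable_def]]
        separable_double_sum[OF assms(5)[unfolded star_separable_def]] set_cst_in_Str)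
      (auto intro: dummy_in_univ)
  then show ?thesis
    unfolding star_separable_def
    by (rule separable_cong)
      (simp add: pullback_sum_cst[OF assms(1-3) _ _ dummy_in_univ dummy_in_univ])
qed

lemma star_separable_sum_nullary_rel:
  assumes "transduction L (rich_vocab \<tau>) \<tau> \<Phi>" "R \<notin> rels \<tau>" "arity R = 0"
    and "agree_invariant (add_rel \<tau> R) v"
    and "star_separable (add_rel \<tau> R) (expand_rel \<Phi> R) v"
  shows "star_separable \<tau> \<Phi> (\<lambda>M. \<Sum>Z\<in>Pow (tuples (univ M) (arity R)). v (set_rel M R Z))"
proof -
  let ?h = "pullback (add_rel \<tau> R) (expand_rel \<Phi> R) v"
  \<comment> \<open>A nullary relation is a truth value, which both components share.\<close>
  have "separable (Str \<tau>) (Str \<tau>) (\<lambda>A B.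
      \<Sum>Z\<in>Pow {[]}. \<Sum>V\<in>{Z}. \<Sum>W\<in>{Z}. ?h (set_rel A R V) (set_rel B R W))"
    by (intro separable_sum separable_double_sum[OF assms(5)[unfolded star_separable_def]]
        set_rel_in_Str)
      (auto simp: assms(3))
  moreover have "?h (set_rel A R Z) (set_rel B R Z) = pullback \<tau> \<Phi> (\<lambda>M. v (set_rel M R Z)) A B"
    if "A \<in> Str \<tau>" "B \<in> Str \<tau>" "Z \<in> Pow {[]}" for A B Z
  proof -
    have "Z = map inl ` Z \<union> map inr ` Z" using that(3) by auto
    then show ?thesis
      using pullback_expand_rel[OF assms(1,2,4) that(1,2) _ _ refl, of Z Z Z] that(3)
      by (simp add: assms(3) pullback_def)
  qed
  ultimately show ?thesis
    unfolding star_separable_def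
    by (elim separable_cong) (simp add: assms(3) pullback_def)
qed

lemma star_separable_sum_unary_rel:
  assumes "vocabulary \<tau>" "transduction L (rich_vocab \<tau>) \<tau> \<Phi>" "R \<notin> rels \<tau>" "arity R = 1"
    and "agree_invariant (add_rel \<tau> R) v" "star_separable (add_rel \<tau> R) (expand_rel \<Phi> R) v"
  shows "star_separable \<tau> \<Phi> (\<lambda>M. \<Sum>Z\<in>Pow (tuples (univ M) (arity R)). v (set_rel M R Z))"
proof -
  let ?\<tau> = "add_rel \<tau> R" and ?\<gamma> = "guard (expand_rel \<Phi> R) (rel_form (RIn R))"
  let ?h = "\<lambda>A B. of_bool (models (rich_union A B) ?\<gamma>) * pullback ?\<tau> (expand_rel \<Phi> R) v A B"
  have voc: "vocabulary ?\<tau>" "vocabulary (rich_vocab ?\<tau>)"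
    by (intro vocabulary_add_rels vocabulary_rich_vocab assms(1))+
  have "sentence L (rich_vocab ?\<tau>) ?\<gamma>"
    using param_form_rel_form[OF voc(2), of "RIn R"] assms(4)
    by (intro sentence_guard[OF voc(2) transduction_expand_rel[OF assms(1,2)]]) simp
  then have "separable (Str ?\<tau>) (Str ?\<tau>) ?h"
    by (intro separable_mult separable_models_rich_union voc(1)
        assms(6)[unfolded star_separable_def])
  then have "separable (Str \<tau>) (Str \<tau>) (\<lambda>A B.
      \<Sum>V\<in>Pow (tuples (univ A) 1). \<Sum>W\<in>Pow (tuples (univ B) 1). ?h (set_rel A R V) (set_rel B R W))"
    by (rule separable_double_sum) (auto intro!: set_rel_in_Str simp: assms(4))
  then show ?thesis
    unfolding star_separable_def assms(4)
    by (rule separable_cong) (rule pullback_sum_unary_rel[OF assms(1-5)])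
qed

lemma star_separable_sum_rel:
  assumes "vocabulary \<tau>" "transduction L (rich_vocab \<tau>) \<tau> \<Phi>" "R \<notin> rels \<tau>" "arity R \<le> 1"
    and "agree_invariant (add_rel \<tau> R) v" "star_separable (add_rel \<tau> R) (expand_rel \<Phi> R) v"
  shows "star_separable \<tau> \<Phi> (\<lambda>M. \<Sum>Z\<in>Pow (tuples (univ M) (arity R)). v (set_rel M R Z))"
proof (cases "arity R = 0")
  case True
  then show ?thesis by (rule star_separable_sum_nullary_rel[OF assms(2,3) _ assms(5,6)])
next
  case False
  then have "arity R = 1" using assms(4) by simp
  then show ?thesis by (rule star_separable_sum_unary_rel[OF assms(1-3) _ assms(5,6)])
qed

theorem star_separable_lpoly:
  assumes "vocabulary \<tau>" "transduction L (rich_vocab \<tau>) \<tau> \<Phi>" "is_lpoly L \<tau> P"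
  shows "star_separable \<tau> \<Phi> (\<lambda>M. lpoly_val M P)"
  using assms
proof (induction P arbitrary: \<tau> \<Phi> rule: lpoly_symbol_induct)
  case (Mono m)
  then show ?case by (simp add: star_separable_mono)
next
  case (SumC_Nil \<phi> p)
  then show ?case
    unfolding lpoly_val_SumC_Nil by (intro star_separable_if_models) (auto simp: is_lpoly.simps)
next
  case (SumR_Nil \<phi> p)
  then show ?case
    unfolding lpoly_val_SumR_Nil by (intro star_separable_if_models) (auto simp: is_lpoly.simps)
next
  case (SumC_Cons c cs \<phi> p)
  note c_new = is_lpoly_SumC_Cons[OF SumC_Cons.prems(3)]
  have "star_separable \<tau> \<Phi> (\<lambda>M. \<Sum>a\<in>univ M. lpoly_val (set_cst M c a) (SumC cs \<phi> p))"
    using c_new SumC_Cons.prems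
    by (intro star_separable_sum_cst SumC_Cons.IH transduction_expand_cst vocabulary_add_csts
        agree_invariant_lpoly_val) auto
  then show ?case
    unfolding star_separable_def
    by (rule separable_cong)
      (use c_new in \<open>simp add: pullback_def lpoly_val_SumC_Cons finite_univ_star\<close>)
next
  case (SumR_Cons R Rs \<phi> p)
  note R_new = is_lpoly_SumR_Cons[OF SumR_Cons.prems(3)]
  have "star_separable \<tau> \<Phi>
      (\<lambda>M. \<Sum>V\<in>Pow (tuples (univ M) (arity R)). lpoly_val (set_rel M R V) (SumR Rs \<phi> p))"
    using R_new SumR_Cons.prems
    by (intro star_separable_sum_rel SumR_Cons.IH transduction_expand_rel vocabulary_add_rels
        agree_invariant_lpoly_val) auto
  then show ?case
    unfolding star_separable_def
    by (rule separable_cong)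
      (use R_new in \<open>simp add: pullback_def lpoly_val_SumR_Cons finite_univ_star\<close>)
qed

end

lemma lpoly_val_isomorphic_star:
  assumes "isomorphic \<tau> N (star \<Phi> (rich_union A B))" "N \<in> Str \<tau>" "is_lpoly L \<tau> P"
  shows "lpoly_val N P = pullback \<tau> \<Phi> (\<lambda>M. lpoly_val M P) A B"
proof -
  obtain f where f: "isomorphism \<tau> f N (star \<Phi> (rich_union A B))"
    using assms(1) by (auto simp: isomorphic_iff_isomorphism)
  have closed: "cst_closed \<tau> N" and "finite (univ N)"
    using assms(2) by (auto simp: Str_def cst_closed_def)
  then show ?thesis
    using lpoly_val_isomorphism[OF f closed _ assms(3)] cst_closed_isomorphism[OF f closed]
    by (simp add: pullback_def)
qed

theorem theorem7p6:
  fixes L :: "form set" and qr :: "form \<Rightarrow> nat" and \<tau> :: vocab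
    and opn :: "struct \<Rightarrow> struct \<Rightarrow> struct" and P :: "'x::{finite,linorder} lpoly"
  assumes "tame_fragment L qr"
    and "rich_union_smooth L qr"
    and "vocabulary \<tau>"
    and "\<And>A B. A \<in> Str \<tau> \<Longrightarrow> B \<in> Str \<tau> \<Longrightarrow> opn A B \<in> Str \<tau>"
    and "sum_like L \<tau> opn"
    and "is_lpoly L \<tau> P"
  shows "matrix_rank (Str \<tau>) (Str \<tau>) (connection_matrix opn P) < \<infinity>"
proof -
  interpret tame_fragment L qr by (rule assms(1))
  interpret smooth_fragment L qr by unfold_locales (rule assms(2))
  obtain \<Phi> where \<Phi>: "transduction L (rich_vocab \<tau>) \<tau> \<Phi>"
    and iso: "\<And>A B. A \<in> Str \<tau> \<Longrightarrow> B \<in> Str \<tau> \<Longrightarrow> isomorphic \<tau> (opn A B) (star \<Phi> (rich_union A B))"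
    using assms(5) by (auto simp: sum_like_def)
  have "separable (Str \<tau>) (Str \<tau>) (pullback \<tau> \<Phi> (\<lambda>M. lpoly_val M P))"
    using star_separable_lpoly[OF assms(3) \<Phi> assms(6)] by (simp add: star_separable_def)
  then have "separable (Str \<tau>) (Str \<tau>) (\<lambda>A B. lpoly_val (opn A B) P)"
    by (rule separable_cong) (rule lpoly_val_isomorphic_star[OF iso assms(4) assms(6)])
  then have "separable (Str \<tau>) (Str \<tau>) (connection_matrix opn P)"
    unfolding connection_matrix_def by (rule separable_hom) simp_all
  then show ?thesis by (rule matrix_rank_separable)
qed

end
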